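(* Let $m$ be an odd number. Assume: (i) every proper divisor $d$ of $m$ ($d<m$) is complete; (ii) there exists an integer $n\ge 0$ such that $o_4(m)>2^n\left\lceil \frac{m}{3\cdot 4^n}\right\rceil$. Then $m$ is complete. If only condition (ii) is satisfied, then $m$ is not primitive.
   Context: Let $\mu$ be the unique Borel probability measure on $\mathbb{R}$ satisfying $\mu(E)=\frac12\left(\mu(\tau_0^{-1}E)+\mu(\tau_2^{-1}E)\right)$ for all Borel sets $E$, where $\tau_0(x)=x/4$, $\tau_2(x)=(x+2)/4$. For odd $m\in\mathbb{N}$ let $\Gamma(m)=\{\sum_{k=0}^n 4^k l_k : l_k\in\{0,m\}, n\in\mathbb{N}\}$; $m$ is complete if $\{e^{2\pi i\lambda x}:\lambda\in\Gamma(m)\}$ is an orthonormal basis of $L^2(\mu)$, incomplete otherwise. $m$ is primitive if it is incomplete and every proper divisor of $m$ (including $1$) is complete. (Known fact from prior work: $m$ is complete iff the only extreme cycle for the digits $\{0,m\}$ is $\{0\}$, where a finite set $\{x_0,\dots,x_{r-1}\}\subset\mathbb{R}$ is an extreme cycle for $\{0,m\}$ if there are $l_0,\dots,l_{r-1}\in\{0,m\}$ with $x_{k+1}=(x_k+l_k)/4$ for $0\le k\le r-2$, $x_0=(x_{r-1}+l_{r-1})/4$, and $\left|\frac{1+e^{2\pi i\cdot 2x_k}}{2}\right|=1$ for all $k$.) $o_4(m)$ is the smallest positive integer $a$ with $4^a\equiv 1\pmod m$; $\lceil x\rceil$ is the smallest integer $\ge x$. *)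

theory Defs
  imports "HOL-Probability.Probability" "HOL-Number_Theory.Number_Theory"
begin

text \<open>The contractions \<open>\<tau>\<^sub>0\<close> and \<open>\<tau>\<^sub>2\<close> are \<open>tau 0\<close> and \<open>tau 2\<close>.\<close>

definition tau :: "real \<Rightarrow> real \<Rightarrow> real" where
  "tau b x = (x + b) / 4"

text \<open>There is exactly one measure with this property (Hutchinson). It is taken as a
  parameter below, so that results hold for every measure with the property.\<close>

definition cantor4_measure :: "real measure \<Rightarrow> bool" where
  "cantor4_measure \<mu> \<longleftrightarrow> prob_space \<mu> \<and> sets \<mu> = sets borel \<and>
     (\<forall>E\<in>sets borel. measure \<mu> E = (measure \<mu> (tau 0 -` E) + measure \<mu> (tau 2 -` E)) / 2)"

text \<open>\<open>L\<^sup>2(\<mu>)\<close> is represented by square-integrable functions rather than by their classes modulo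
  almost everywhere equality.\<close>

definition L2_space :: "real measure \<Rightarrow> (real \<Rightarrow> complex) set" where
  "L2_space \<mu> = {f \<in> borel_measurable \<mu>. integrable \<mu> (\<lambda>x. (cmod (f x))\<^sup>2)}"

definition L2_inner :: "real measure \<Rightarrow> (real \<Rightarrow> complex) \<Rightarrow> (real \<Rightarrow> complex) \<Rightarrow> complex" where
  "L2_inner \<mu> f g = (\<integral>x. f x * cnj (g x) \<partial>\<mu>)"

definition L2_norm :: "real measure \<Rightarrow> (real \<Rightarrow> complex) \<Rightarrow> real" where
  "L2_norm \<mu> f = sqrt (\<integral>x. (cmod (f x))\<^sup>2 \<partial>\<mu>)"

text \<open>The classes of the elements of \<open>B\<close> form an orthonormal set, hence the test for
  almost everywhere equality instead of \<open>f = g\<close>, and have dense complex linear span.\<close>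

definition orthonormal_basis_L2 :: "real measure \<Rightarrow> (real \<Rightarrow> complex) set \<Rightarrow> bool" where
  "orthonormal_basis_L2 \<mu> B \<longleftrightarrow>
     B \<subseteq> L2_space \<mu> \<and>
     (\<forall>f\<in>B. \<forall>g\<in>B. L2_inner \<mu> f g = (if AE x in \<mu>. f x = g x then 1 else 0)) \<and>
     (\<forall>f\<in>L2_space \<mu>. \<forall>\<epsilon>>0. \<exists>S c. finite S \<and> S \<subseteq> B \<and>
        L2_norm \<mu> (\<lambda>x. f x - (\<Sum>e\<in>S. c e * e x)) < \<epsilon>)"

definition Gamma_set :: "nat \<Rightarrow> nat set" where
  "Gamma_set m = {(\<Sum>k\<le>n. 4 ^ k * l k) | n l. \<forall>k\<le>n. l k \<in> {0, m}}"

definition expo :: "nat \<Rightarrow> real \<Rightarrow> complex" where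
  "expo l x = exp (2 * of_real pi * \<i> * of_nat l * of_real x)"

text \<open>The next two notions are only meaningful for odd \<open>m\<close>.\<close>

definition complete_number :: "real measure \<Rightarrow> nat \<Rightarrow> bool" where
  "complete_number \<mu> m \<longleftrightarrow> orthonormal_basis_L2 \<mu> (expo ` Gamma_set m)"

definition primitive_number :: "real measure \<Rightarrow> nat \<Rightarrow> bool" where
  "primitive_number \<mu> m \<longleftrightarrow> \<not> complete_number \<mu> m \<and>
     (\<forall>d. d dvd m \<and> d < m \<longrightarrow> complete_number \<mu> d)"

end

(* Let m be odd and write phi(t) for the integral of e^{2 pi i t x} d mu. Self-similarity gives
   phi(t) = phi(t/4) (1 + e^{i pi t})/2, so on integers phi(4 t) = phi(t) and phi vanishes at odd t.

   If x_0, x_1, ... is a nonzero extreme cycle, then every lambda + x_k with lambda in Gamma(m) is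
   4^j times an odd number. Thus e_{-x_0} is orthogonal to all e_lambda, and m is not complete.

   Conversely let h(t) be the sum of |phi(t + lambda)|^2 over lambda in Gamma(m), the squared length of
   the projection of e_{-t}. It satisfies h(t) = cos^2(pi t/2) h(t/4) + sin^2(pi t/2) h((t+m)/4). If its
   minimum c on a large symmetric interval is below 1, then the set of minimum points is closed under all
   steps of positive weight. A minimum point t that is not an integer would give minimum points
   t/4^n -> 0, contradicting h >= |phi|^2 and phi(0) = 1. So the minimum points are finitely many nonzero
   integers, and following their unique steps produces an extreme cycle. Without cycles, h = 1, all
   exponentials lie in the closed span, and they are total in L^2(mu).

   Let now x be an extreme cycle for m. If d = gcd(x_0, m) > 1, then x/d is an extreme cycle for the proper
   divisor m/d. If d = 1, then the x_k run through at least o_4(m) values, because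
   4^k x_k = x_0 (mod m). All values lie in (0, m/3] and hence, tracing n steps back, in 2^n
   intervals (m a/4^n, m a/4^n + m/(3 4^n)], each with at most ceil(m/(3 4^n)) integers. *)

theory Submission
  imports Defs
begin

section \<open>Linear spans and their closure in \<open>L\<^sup>2\<close>\<close>

text \<open>Adding one term at a time lets closure properties be proved by induction.
  \<open>cspan_explicit\<close> translates back to the finite sums in the definition of a
  basis.\<close>

inductive_set cspan :: "('a \<Rightarrow> complex) set \<Rightarrow> ('a \<Rightarrow> complex) set" for B where
  zero: "(\<lambda>_. 0) \<in> cspan B"
| step: "f \<in> cspan B \<Longrightarrow> e \<in> B \<Longrightarrow> (\<lambda>x. c * e x + f x) \<in> cspan B"

lemma cspan_superset: "e \<in> B \<Longrightarrow> e \<in> cspan B"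
  using cspan.step[OF cspan.zero, of e B 1] by simp

lemma cspan_scale: "f \<in> cspan B \<Longrightarrow> (\<lambda>x. c * f x) \<in> cspan B"
proof (induction rule: cspan.induct)
  case (step f e c')
  then show ?case
    using cspan.step[of "\<lambda>x. c * f x" B e "c * c'"] by (simp add: algebra_simps)
qed (simp add: cspan.zero)

lemma cspan_add: "f \<in> cspan B \<Longrightarrow> g \<in> cspan B \<Longrightarrow> (\<lambda>x. f x + g x) \<in> cspan B"
proof (induction rule: cspan.induct)
  case (step f e c)
  then show ?case
    using cspan.step[of "\<lambda>x. f x + g x" B e c] by (simp add: algebra_simps)
qed simp

text \<open>If the generators are closed under products, their span is an algebra. This is what
  Stone-Weierstrass will ask of the exponentials.\<close>

lemma cspan_mult:
  assumes B: "\<And>d e. d \<in> B \<Longrightarrow> e \<in> B \<Longrightarrow> (\<lambda>x. d x * e x) \<in> B"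
    and "f \<in> cspan B" "g \<in> cspan B"
  shows "(\<lambda>x. f x * g x) \<in> cspan B"
  using assms(2)
proof (induction rule: cspan.induct)
  case (step f d c)
  have "(\<lambda>x. d x * g x) \<in> cspan B"
    using \<open>g \<in> cspan B\<close>
  proof (induction rule: cspan.induct)
    case (step g e c)
    then show ?case
      using cspan.step[OF step.IH B[OF \<open>d \<in> B\<close> step.hyps(2)], of c] by (simp add: algebra_simps)
  qed (simp add: cspan.zero)
  from cspan_add[OF cspan_scale[OF this, of c] step.IH]
  show ?case by (simp add: algebra_simps)
qed (simp add: cspan.zero)

lemma cspan_sum:
  "finite S \<Longrightarrow> (\<And>i. i \<in> S \<Longrightarrow> f i \<in> cspan B) \<Longrightarrow> (\<lambda>x. \<Sum>i\<in>S. f i x) \<in> cspan B"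
  by (induction rule: finite_induct) (auto intro: cspan.zero cspan_add)

lemma cspan_explicit:
  assumes "f \<in> cspan B"
  shows "\<exists>S c. finite S \<and> S \<subseteq> B \<and> f = (\<lambda>x. \<Sum>e\<in>S. c e * e x)"
  using assms
proof (induction rule: cspan.induct)
  case zero
  show ?case by (rule exI[of _ "{}"]) simp
next
  case (step f e a)
  then obtain S c where S: "finite S" "S \<subseteq> B" "f = (\<lambda>x. \<Sum>e\<in>S. c e * e x)"
    by blast
  \<comment> \<open>The new generator \<open>e\<close> may already occur in \<open>S\<close>, in
    which case the two coefficients add up. Outside \<open>S\<close> the function \<open>c\<close>
    is arbitrary, so it is cut off to 0.\<close>
  define c' where "c' d = (if d \<in> S then c d else 0) + (if d = e then a else 0)" for d
  have "(\<lambda>x. a * e x + f x) = (\<lambda>x. \<Sum>d\<in>insert e S. c' d * d x)"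
  proof
    fix x
    have "(\<Sum>d\<in>insert e S. c' d * d x) =
        (\<Sum>d\<in>insert e S. (if d \<in> S then c d * d x else 0)) + (\<Sum>d\<in>insert e S. (if d = e then a * d x else 0))"
      unfolding c'_def sum.distrib[symmetric] by (intro sum.cong) (auto simp: algebra_simps)
    also have "(\<Sum>d\<in>insert e S. (if d \<in> S then c d * d x else 0)) = f x"
      unfolding S(3) using S(1) by (intro sum.mono_neutral_cong_right) auto
    also have "(\<Sum>d\<in>insert e S. (if d = e then a * d x else 0)) = a * e x"
      using S(1) by (subst sum.delta) auto
    finally show "a * e x + f x = (\<Sum>d\<in>insert e S. c' d * d x)" by simp
  qed
  then show ?case
    using S(1,2) step.hyps by (intro exI[of _ "insert e S"] exI[of _ c']) auto
qed

text \<open>Squared distances are used throughout, so that no square root enters the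
  estimates.\<close>

definition L2_closure :: "real measure \<Rightarrow> (real \<Rightarrow> complex) set \<Rightarrow> (real \<Rightarrow> complex) set" where
  "L2_closure \<mu> B = {f \<in> L2_space \<mu>. \<forall>\<epsilon>>0. \<exists>g\<in>cspan B. (\<integral>x. (cmod (f x - g x))\<^sup>2 \<partial>\<mu>) < \<epsilon>}"

text \<open>Replaces the triangle inequality of the norm: integrated, it bounds squared distances at
  the cost of a factor 2.\<close>

lemma cmod_add_squared_le: "(cmod (a + b))\<^sup>2 \<le> 2 * (cmod a)\<^sup>2 + 2 * (cmod b)\<^sup>2"
proof -
  have "(cmod (a + b))\<^sup>2 \<le> (cmod a + cmod b)\<^sup>2"
    by (intro power_mono norm_triangle_ineq) auto
  also have "\<dots> \<le> 2 * (cmod a)\<^sup>2 + 2 * (cmod b)\<^sup>2"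
    using sum_squares_bound[of "cmod a" "cmod b"] by (simp add: power2_sum)
  finally show ?thesis .
qed

lemma L2_spaceI_bound:
  assumes [measurable]: "f \<in> borel_measurable \<mu>" "w \<in> borel_measurable \<mu>"
    and w: "integrable \<mu> w" and "AE x in \<mu>. (cmod (f x))\<^sup>2 \<le> w x"
  shows "f \<in> L2_space \<mu>"
  unfolding L2_space_def using assms(4)
  by (auto intro!: Bochner_Integration.integrable_bound[OF w] elim!: eventually_mono)

lemma L2_space_add: "f \<in> L2_space \<mu> \<Longrightarrow> g \<in> L2_space \<mu> \<Longrightarrow> (\<lambda>x. f x + g x) \<in> L2_space \<mu>"
  by (rule L2_spaceI_bound[where w = "\<lambda>x. 2 * (cmod (f x))\<^sup>2 + 2 * (cmod (g x))\<^sup>2"])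
     (auto simp: L2_space_def cmod_add_squared_le)

lemma L2_space_scale: "f \<in> L2_space \<mu> \<Longrightarrow> (\<lambda>x. c * f x) \<in> L2_space \<mu>"
  by (auto simp: L2_space_def norm_mult power_mult_distrib)

lemma L2_space_diff: "f \<in> L2_space \<mu> \<Longrightarrow> g \<in> L2_space \<mu> \<Longrightarrow> (\<lambda>x. f x - g x) \<in> L2_space \<mu>"
  using L2_space_add[OF _ L2_space_scale[of g \<mu> "-1"], of f] by simp

lemma L2_space_0: "(\<lambda>_. 0) \<in> L2_space \<mu>"
  by (auto simp: L2_space_def)

lemma integral_add_squared_le:
  assumes "f \<in> L2_space \<mu>" "g \<in> L2_space \<mu>"
  shows "(\<integral>x. (cmod (f x + g x))\<^sup>2 \<partial>\<mu>) \<le> 2 * (\<integral>x. (cmod (f x))\<^sup>2 \<partial>\<mu>) + 2 * (\<integral>x. (cmod (g x))\<^sup>2 \<partial>\<mu>)"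
proof -
  have int: "integrable \<mu> (\<lambda>x. (cmod (f x))\<^sup>2)" "integrable \<mu> (\<lambda>x. (cmod (g x))\<^sup>2)"
    "integrable \<mu> (\<lambda>x. (cmod (f x + g x))\<^sup>2)"
    using assms L2_space_add[OF assms] by (auto simp: L2_space_def)
  have "(\<integral>x. (cmod (f x + g x))\<^sup>2 \<partial>\<mu>) \<le> (\<integral>x. 2 * (cmod (f x))\<^sup>2 + 2 * (cmod (g x))\<^sup>2 \<partial>\<mu>)"
    using int by (intro integral_mono cmod_add_squared_le) auto
  then show ?thesis using int by simp
qed

lemma cspan_L2_space: "B \<subseteq> L2_space \<mu> \<Longrightarrow> f \<in> cspan B \<Longrightarrow> f \<in> L2_space \<mu>"
  by (rotate_tac, induction rule: cspan.induct)
     (auto intro!: L2_space_add L2_space_scale L2_space_0)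

lemma L2_closure_L2_space: "f \<in> L2_closure \<mu> B \<Longrightarrow> f \<in> L2_space \<mu>"
  by (simp add: L2_closure_def)

lemma cspan_L2_closure:
  assumes "B \<subseteq> L2_space \<mu>" "f \<in> cspan B"
  shows "f \<in> L2_closure \<mu> B"
  using cspan_L2_space[OF assms] assms(2) unfolding L2_closure_def by (auto intro!: bexI[of _ f])

text \<open>The closure is closed: approximate \<open>f\<close> by \<open>g\<close> and
  \<open>g\<close> by a span element. The factor 2 in \<open>integral_add_squared_le\<close>
  explains the two errors of \<open>\<epsilon> / 4\<close>.\<close>

lemma L2_closure_limit:
  assumes B: "B \<subseteq> L2_space \<mu>" and f: "f \<in> L2_space \<mu>"
    and lim: "\<And>\<epsilon>. \<epsilon> > 0 \<Longrightarrow> \<exists>g\<in>L2_closure \<mu> B. (\<integral>x. (cmod (f x - g x))\<^sup>2 \<partial>\<mu>) < \<epsilon>"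
  shows "f \<in> L2_closure \<mu> B"
  unfolding L2_closure_def
proof (intro CollectI conjI allI impI f)
  fix \<epsilon> :: real assume "\<epsilon> > 0"
  then obtain g where g: "g \<in> L2_closure \<mu> B" "(\<integral>x. (cmod (f x - g x))\<^sup>2 \<partial>\<mu>) < \<epsilon> / 4"
    using lim[of "\<epsilon> / 4"] by auto
  with \<open>\<epsilon> > 0\<close> obtain h where h: "h \<in> cspan B" "(\<integral>x. (cmod (g x - h x))\<^sup>2 \<partial>\<mu>) < \<epsilon> / 4"
    unfolding L2_closure_def by (auto dest!: spec[of _ "\<epsilon> / 4"])
  have "(\<integral>x. (cmod (f x - h x))\<^sup>2 \<partial>\<mu>) = (\<integral>x. (cmod ((f x - g x) + (g x - h x)))\<^sup>2 \<partial>\<mu>)"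
    by simp
  also have "\<dots> \<le> 2 * (\<integral>x. (cmod (f x - g x))\<^sup>2 \<partial>\<mu>) + 2 * (\<integral>x. (cmod (g x - h x))\<^sup>2 \<partial>\<mu>)"
    using f L2_closure_L2_space[OF g(1)] cspan_L2_space[OF B h(1)]
    by (intro integral_add_squared_le L2_space_diff)
  also have "\<dots> < \<epsilon>" using g(2) h(2) by simp
  finally show "\<exists>g\<in>cspan B. (\<integral>x. (cmod (f x - g x))\<^sup>2 \<partial>\<mu>) < \<epsilon>" using h(1) by blast
qed

lemma L2_closure_add:
  assumes B: "B \<subseteq> L2_space \<mu>" and f: "f \<in> L2_closure \<mu> B" and g: "g \<in> L2_closure \<mu> B"
  shows "(\<lambda>x. f x + g x) \<in> L2_closure \<mu> B"
proof (rule L2_closure_limit[OF B])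
  fix \<epsilon> :: real assume "\<epsilon> > 0"
  then obtain p q where p: "p \<in> cspan B" "(\<integral>x. (cmod (f x - p x))\<^sup>2 \<partial>\<mu>) < \<epsilon> / 4"
    and q: "q \<in> cspan B" "(\<integral>x. (cmod (g x - q x))\<^sup>2 \<partial>\<mu>) < \<epsilon> / 4"
    using f g unfolding L2_closure_def by (auto dest!: spec[of _ "\<epsilon> / 4"])
  have "(\<integral>x. (cmod ((f x + g x) - (p x + q x)))\<^sup>2 \<partial>\<mu>) = (\<integral>x. (cmod ((f x - p x) + (g x - q x)))\<^sup>2 \<partial>\<mu>)"
    by (simp add: algebra_simps)
  also have "\<dots> \<le> 2 * (\<integral>x. (cmod (f x - p x))\<^sup>2 \<partial>\<mu>) + 2 * (\<integral>x. (cmod (g x - q x))\<^sup>2 \<partial>\<mu>)"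
    using L2_closure_L2_space[OF f] L2_closure_L2_space[OF g] cspan_L2_space[OF B] p(1) q(1)
    by (intro integral_add_squared_le L2_space_diff) auto
  also have "\<dots> < \<epsilon>" using p(2) q(2) by simp
  finally show "\<exists>h\<in>L2_closure \<mu> B. (\<integral>x. (cmod (f x + g x - h x))\<^sup>2 \<partial>\<mu>) < \<epsilon>"
    using cspan_L2_closure[OF B cspan_add[OF p(1) q(1)]] by (intro bexI)
qed (use f g in \<open>auto intro!: L2_space_add dest: L2_closure_L2_space\<close>)

lemma L2_closure_scale:
  assumes B: "B \<subseteq> L2_space \<mu>" and f: "f \<in> L2_closure \<mu> B"
  shows "(\<lambda>x. c * f x) \<in> L2_closure \<mu> B"
proof (rule L2_closure_limit[OF B])
  fix \<epsilon> :: real assume "\<epsilon> > 0"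
  \<comment> \<open>The summand 1 keeps the denominator positive when \<open>c = 0\<close>.\<close>
  then have pos: "\<epsilon> / ((cmod c)\<^sup>2 + 1) > 0"
    by (intro divide_pos_pos) (auto intro: add_nonneg_pos)
  then obtain p where p: "p \<in> cspan B" "(\<integral>x. (cmod (f x - p x))\<^sup>2 \<partial>\<mu>) < \<epsilon> / ((cmod c)\<^sup>2 + 1)"
    using f unfolding L2_closure_def by blast
  have "(\<integral>x. (cmod (c * f x - c * p x))\<^sup>2 \<partial>\<mu>) = (cmod c)\<^sup>2 * (\<integral>x. (cmod (f x - p x))\<^sup>2 \<partial>\<mu>)"
    by (simp flip: right_diff_distrib add: norm_mult power_mult_distrib)
  also have "\<dots> \<le> ((cmod c)\<^sup>2 + 1) * (\<integral>x. (cmod (f x - p x))\<^sup>2 \<partial>\<mu>)"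
    by (intro mult_right_mono) auto
  also have "\<dots> < \<epsilon>"
    using p(2) by (subst (asm) less_divide_eq) (auto simp: mult.commute add_nonneg_pos split: if_splits)
  finally show "\<exists>h\<in>L2_closure \<mu> B. (\<integral>x. (cmod (c * f x - h x))\<^sup>2 \<partial>\<mu>) < \<epsilon>"
    using cspan_L2_closure[OF B cspan_scale[OF p(1)]] by (intro bexI)
qed (use f in \<open>auto intro!: L2_space_scale dest: L2_closure_L2_space\<close>)

lemma cspan_in_L2_closure:
  assumes B: "B \<subseteq> L2_space \<mu>" and A: "A \<subseteq> L2_closure \<mu> B" and f: "f \<in> cspan A"
  shows "f \<in> L2_closure \<mu> B"
  using f
proof (induction rule: cspan.induct)
  case zero
  show ?case by (rule cspan_L2_closure[OF B cspan.zero])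
next
  case (step f e c)
  then show ?case using A by (intro L2_closure_add[OF B] L2_closure_scale[OF B]) auto
qed

lemma L2_closure_sum:
  assumes B: "B \<subseteq> L2_space \<mu>" and "finite S" and "\<And>i. i \<in> S \<Longrightarrow> f i \<in> L2_closure \<mu> B"
  shows "(\<lambda>x. \<Sum>i\<in>S. f i x) \<in> L2_closure \<mu> B"
  using assms(2,3)
  by (induction rule: finite_induct)
     (auto intro: cspan_L2_closure[OF B cspan.zero] L2_closure_add[OF B])

lemma L2_closure_trans:
  assumes B: "B \<subseteq> L2_space \<mu>" and A: "A \<subseteq> L2_closure \<mu> B" and f: "f \<in> L2_closure \<mu> A"
  shows "f \<in> L2_closure \<mu> B"
proof (rule L2_closure_limit[OF B L2_closure_L2_space[OF f]])
  fix \<epsilon> :: real assume "\<epsilon> > 0"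
  with f obtain g where "g \<in> cspan A" "(\<integral>x. (cmod (f x - g x))\<^sup>2 \<partial>\<mu>) < \<epsilon>"
    unfolding L2_closure_def by blast
  then show "\<exists>g\<in>L2_closure \<mu> B. (\<integral>x. (cmod (f x - g x))\<^sup>2 \<partial>\<mu>) < \<epsilon>"
    using cspan_in_L2_closure[OF B A] by blast
qed

text \<open>With a square integrable bound \<open>w\<close>, dominated convergence turns pointwise
  limits into limits in the mean. The squared differences are dominated by
  \<open>4 * (w x)\<^sup>2\<close>.\<close>

lemma L2_closure_dominated:
  assumes B: "B \<subseteq> L2_space \<mu>" and F: "\<And>n. F n \<in> L2_closure \<mu> B"
    and f[measurable]: "f \<in> borel_measurable \<mu>" and w: "integrable \<mu> (\<lambda>x. (w x)\<^sup>2)"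
    and bound: "\<And>n x. x \<in> space \<mu> \<Longrightarrow> cmod (F n x) \<le> w x"
    and lim: "\<And>x. x \<in> space \<mu> \<Longrightarrow> (\<lambda>n. F n x) \<longlonglongrightarrow> f x"
  shows "f \<in> L2_closure \<mu> B"
proof -
  have [measurable]: "F n \<in> borel_measurable \<mu>" for n
    using L2_closure_L2_space[OF F] by (simp add: L2_space_def)
  have fw: "cmod (f x) \<le> w x" if "x \<in> space \<mu>" for x
    using lim[OF that] bound[OF that] by (intro LIMSEQ_le_const2[OF tendsto_norm]) auto
  have "f \<in> L2_space \<mu>"
    by (rule L2_spaceI_bound[OF f _ w]) (use w fw in \<open>auto intro!: AE_I2 power_mono\<close>)
  have *: "(\<lambda>n. \<integral>x. (cmod (f x - F n x))\<^sup>2 \<partial>\<mu>) \<longlonglongrightarrow> (\<integral>x. 0 \<partial>\<mu>)"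
  proof (rule integral_dominated_convergence[where w = "\<lambda>x. 4 * (w x)\<^sup>2"])
    show "AE x in \<mu>. (\<lambda>n. (cmod (f x - F n x))\<^sup>2) \<longlonglongrightarrow> 0"
    proof (rule AE_I2)
      fix x assume "x \<in> space \<mu>"
      from tendsto_power[OF tendsto_norm[OF tendsto_diff[OF tendsto_const lim[OF this], of "f x"]], of 2]
      show "(\<lambda>n. (cmod (f x - F n x))\<^sup>2) \<longlonglongrightarrow> 0" by simp
    qed
    show "AE x in \<mu>. norm ((cmod (f x - F n x))\<^sup>2) \<le> 4 * (w x)\<^sup>2" for n
    proof (rule AE_I2)
      fix x assume x: "x \<in> space \<mu>"
      have "cmod (f x - F n x) \<le> 2 * w x"
        using norm_triangle_ineq4[of "f x" "F n x"] fw[OF x] bound[OF x, of n] by linarith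
      from power_mono[OF this, of 2] show "norm ((cmod (f x - F n x))\<^sup>2) \<le> 4 * (w x)\<^sup>2"
        by simp
    qed
  qed (use w in auto)
  show ?thesis
  proof (rule L2_closure_limit[OF B \<open>f \<in> L2_space \<mu>\<close>])
    fix \<epsilon> :: real assume "\<epsilon> > 0"
    then obtain n where "(\<integral>x. (cmod (f x - F n x))\<^sup>2 \<partial>\<mu>) < \<epsilon>"
      using order_tendstoD(2)[OF *, of \<epsilon>] by (auto simp: eventually_sequentially)
    then show "\<exists>g\<in>L2_closure \<mu> B. (\<integral>x. (cmod (f x - g x))\<^sup>2 \<partial>\<mu>) < \<epsilon>"
      using F by blast
  qed
qed

section \<open>Exponentials with real frequency and their totality on the unit interval\<close>

definition wave :: "real \<Rightarrow> real \<Rightarrow> complex" where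
  "wave t x = cis (2 * pi * t * x)"

lemma cmod_wave [simp]: "cmod (wave t x) = 1"
  by (simp add: wave_def)

lemma wave_mult: "wave s x * wave t x = wave (s + t) x"
  by (simp add: wave_def cis_mult algebra_simps)

lemma cnj_wave: "cnj (wave t x) = wave (- t) x"
  by (simp add: wave_def cis_cnj)

lemma wave_0 [simp]: "wave 0 x = 1"
  by (simp add: wave_def)

lemma continuous_wave: "continuous_on A (wave t)"
  unfolding wave_def[abs_def] cis_conv_exp by (intro continuous_intros)

lemma borel_measurable_wave [measurable]: "wave t \<in> borel_measurable borel"
  by (rule borel_measurable_continuous_onI[OF continuous_wave])

context real_distribution
begin

lemma wave_L2_space: "wave t \<in> L2_space M"
  by (auto simp: L2_space_def)

text \<open>Stone-Weierstrass on the interval that carries the measure: the span of the exponentials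
  is an algebra, contains the constants and separates points.\<close>

lemma continuous_in_wave_closure:
  fixes f :: "real \<Rightarrow> real"
  assumes supp: "AE x in M. x \<in> {0..1}" and f: "continuous_on UNIV f"
    and f1: "\<And>x. \<bar>f x\<bar> \<le> 1"
  shows "(\<lambda>x. complex_of_real (f x)) \<in> L2_closure M (range wave)"
proof -
  have waves: "range wave \<subseteq> L2_space M" using wave_L2_space by auto
  \<comment> \<open>Stone-Weierstrass is applied to real functions, so \<open>R\<close> collects the
    real-valued members of the complex span.\<close>
  define R where "R = {g :: real \<Rightarrow> real. (\<lambda>x. complex_of_real (g x)) \<in> cspan (range wave)}"
  interpret function_ring_on R "{0..1}"
  proof
    fix g h assume "g \<in> R" "h \<in> R"
    moreover have "(\<lambda>x. d x * e x) \<in> range wave" if "d \<in> range wave" "e \<in> range wave" for d e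
      using that by (auto simp: wave_mult)
    ultimately show "(\<lambda>x. g x + h x) \<in> R" "(\<lambda>x. g x * h x) \<in> R"
      unfolding R_def by (auto intro: cspan_add cspan_mult)
  next
    fix g assume "g \<in> R"
    have "continuous_on {0..1} p" if "p \<in> cspan (range wave)" for p
      using that by induction (auto intro!: continuous_intros continuous_wave)
    with \<open>g \<in> R\<close> have "continuous_on {0..1} (\<lambda>x. Re (complex_of_real (g x)))"
      unfolding R_def by (intro continuous_on_Re) blast
    then show "continuous_on {0..1} g" by simp
  next
    fix c
    show "(\<lambda>_. c) \<in> R"
      unfolding R_def using cspan_scale[OF cspan_superset[of "wave 0" "range wave"], of "of_real c"]
      by (simp add: wave_def)
  next
    fix x y :: real assume xy: "x \<in> {0..1}" "y \<in> {0..1}" "x \<noteq> y"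
    \<comment> \<open>One function separates all points, as the cosine is injective on
      \<open>{0..pi}\<close>. The frequency 1/2 matters: exponentials of integer frequency agree at
      0 and 1.\<close>
    have "(\<lambda>x. complex_of_real (cos (pi * x))) = (\<lambda>x. 1 / 2 * wave (1 / 2) x + 1 / 2 * wave (- 1 / 2) x)"
      by (auto simp: wave_def complex_eq_iff)
    then have "(\<lambda>x. cos (pi * x)) \<in> R"
      unfolding R_def mem_Collect_eq by (simp only:) (intro cspan_add cspan_scale cspan_superset rangeI)
    moreover have "cos (pi * x) \<noteq> cos (pi * y)"
    proof
      assume "cos (pi * x) = cos (pi * y)"
      moreover have "0 \<le> pi * x" "pi * x \<le> pi" "0 \<le> pi * y" "pi * y \<le> pi"
        using xy mult_left_mono[of x 1 pi] mult_left_mono[of y 1 pi] by simp_all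
      ultimately have "pi * x = pi * y" by (metis cos_inj_pi)
      with xy show False by simp
    qed
    ultimately show "\<exists>f\<in>R. f x \<noteq> f y" by (rule bexI[of _ "\<lambda>x. cos (pi * x)", rotated])
  qed simp
  have [measurable]: "f \<in> borel_measurable M"
    using borel_measurable_continuous_onI[OF f] by simp
  show ?thesis
  proof (rule L2_closure_limit[OF waves])
    have "(f x)\<^sup>2 \<le> 1" for x using f1[of x] by (simp add: abs_square_le_1)
    then show "(\<lambda>x. complex_of_real (f x)) \<in> L2_space M"
      by (intro L2_spaceI_bound[where w = "\<lambda>_. 1"]) auto
    fix \<epsilon> :: real assume "\<epsilon> > 0"
    \<comment> \<open>With \<open>\<delta> \<le> 1\<close> the squared uniform error is at most
      \<open>\<delta>\<close>, which is below \<open>\<epsilon>\<close>.\<close>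
    define \<delta> where "\<delta> = min 1 (\<epsilon> / 2)"
    have \<delta>: "0 < \<delta>" "\<delta> \<le> 1" "\<delta> < \<epsilon>" using \<open>\<epsilon> > 0\<close> by (auto simp: \<delta>_def)
    obtain g where g: "g \<in> R" "\<And>x. x \<in> {0..1} \<Longrightarrow> \<bar>f x - g x\<bar> < \<delta>"
      using Stone_Weierstrass_basic[OF continuous_on_subset[OF f] \<delta>(1)] by auto
    then have gc: "(\<lambda>x. complex_of_real (g x)) \<in> cspan (range wave)" by (simp add: R_def)
    have "(\<lambda>x. complex_of_real (f x) - complex_of_real (g x)) \<in> L2_space M"
      by (intro L2_space_diff cspan_L2_space[OF waves gc]) fact
    then have "(\<integral>x. (cmod (complex_of_real (f x) - complex_of_real (g x)))\<^sup>2 \<partial>M) \<le> (\<integral>x. \<delta> \<partial>M)"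
    proof (intro integral_mono_AE)
      show "AE x in M. (cmod (complex_of_real (f x) - complex_of_real (g x)))\<^sup>2 \<le> \<delta>"
        using supp
      proof eventually_elim
        fix x :: real assume "x \<in> {0..1}"
        then have "\<bar>f x - g x\<bar>\<^sup>2 \<le> \<delta>\<^sup>2"
          using g(2)[of x] by (intro power_mono) auto
        also have "\<dots> \<le> \<delta>" using \<delta> by (simp add: power2_eq_square mult_left_le_one_le)
        finally show "(cmod (complex_of_real (f x) - complex_of_real (g x)))\<^sup>2 \<le> \<delta>"
          by (simp flip: of_real_diff)
      qed
    qed (auto simp: L2_space_def)
    also have "\<dots> < \<epsilon>" using \<delta> by (simp add: prob_space del: space_eq_univ)
    finally show "\<exists>h\<in>L2_closure M (range wave). (\<integral>x. (cmod (complex_of_real (f x) - h x))\<^sup>2 \<partial>M) < \<epsilon>"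
      using cspan_L2_closure[OF waves gc] by (intro bexI)
  qed
qed

text \<open>Induction over the Borel sets: intervals are limits of continuous functions, complements
  are differences, and disjoint unions are limits of finite sums.\<close>

lemma indicator_in_wave_closure:
  assumes supp: "AE x in M. x \<in> {0..1}" and A: "A \<in> sets borel"
  shows "(indicator A :: real \<Rightarrow> complex) \<in> L2_closure M (range wave)"
proof -
  have waves: "range wave \<subseteq> L2_space M" using wave_L2_space by auto
  note limit = L2_closure_dominated[OF waves, where w = "\<lambda>_. 1"]
  have cont: "(\<lambda>x. complex_of_real (f x)) \<in> L2_closure M (range wave)"
    if "continuous_on UNIV f" "\<And>x. \<bar>f x\<bar> \<le> 1" for f
    using continuous_in_wave_closure[OF supp that] .
  show ?thesis
    using A
  proof (induction rule: borel_set_induct)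
    case empty
    show ?case using cspan_L2_closure[OF waves cspan.zero] by (simp add: indicator_def[abs_def])
  next
    case (interval a b)
    \<comment> \<open>Trapezoids: 1 on the interval and falling with slope \<open>n\<close> on both
      sides until they reach 0.\<close>
    define f where "f n x = max 0 (1 - real n * max 0 (max (a - x) (x - b)))" for n x
    show ?case
    proof (rule limit)
      show "(\<lambda>x. complex_of_real (f n x)) \<in> L2_closure M (range wave)" for n
        by (rule cont) (auto simp: f_def intro!: continuous_intros)
      show "(\<lambda>n. complex_of_real (f n x)) \<longlonglongrightarrow> indicator {a..b} x" for x
      proof (cases "x \<in> {a..b}")
        case True
        then have "max 0 (max (a - x) (x - b)) = 0" by auto
        then show ?thesis using True by (simp add: f_def)
      next
        case False
        define d where "d = max 0 (max (a - x) (x - b))"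
        have "d > 0" using False by (auto simp: d_def)
        then obtain N where N: "1 < real N * d"
          using reals_Archimedean3 by blast
        have "f n x = 0" if "n \<ge> N" for n
        proof -
          have "real N * d \<le> real n * d" using that \<open>d > 0\<close> by (intro mult_right_mono) auto
          with N show ?thesis by (simp add: f_def d_def[symmetric])
        qed
        then have "\<forall>\<^sub>F n in sequentially. complex_of_real (f n x) = indicator {a..b} x"
          using False by (intro eventually_mono[OF eventually_ge_at_top[of N]]) auto
        then show ?thesis by (rule tendsto_eventually)
      qed
      show "cmod (complex_of_real (f n x)) \<le> 1" for n x
        by (auto simp: f_def)
    qed auto
  next
    case (compl A)
    have "(\<lambda>x. complex_of_real 1 + (- 1) * indicator A x) \<in> L2_closure M (range wave)"
      using compl by (intro L2_closure_add L2_closure_scale waves cont) auto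
    also have "(\<lambda>x. complex_of_real 1 + (- 1) * indicator A x) = indicator (- A)"
      by (auto simp: indicator_def)
    finally show ?case .
  next
    case (union A)
    show ?case
    proof (rule limit)
      show "(indicator (\<Union>i<n. A i) :: real \<Rightarrow> complex) \<in> L2_closure M (range wave)" for n
      proof -
        have "(\<lambda>x. \<Sum>i<n. indicator (A i) x) \<in> L2_closure M (range wave)"
          using union(3) by (intro L2_closure_sum[OF waves]) auto
        moreover have "(\<lambda>x. \<Sum>i<n. indicator (A i) x :: complex) = indicator (\<Union>i<n. A i)"
          using union(1)
          by (intro ext indicator_UN_disjoint[symmetric]) (auto simp: disjoint_family_on_def)
        ultimately show ?thesis by simp
      qed
      show "(\<lambda>n. indicator (\<Union>i<n. A i) x :: complex) \<longlonglongrightarrow> indicator (\<Union>i. A i) x" for x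
        by (rule LIMSEQ_indicator_UN)
      show "(indicator (\<Union>i. A i) :: real \<Rightarrow> complex) \<in> borel_measurable M"
        using union(2) by (intro borel_measurable_indicator) auto
    qed (auto simp: indicator_def)
  qed
qed

text \<open>Simple functions converging to \<open>f\<close> and dominated by
  \<open>2 * cmod (f x)\<close> are finite combinations of indicators.\<close>

lemma waves_total:
  assumes supp: "AE x in M. x \<in> {0..1}" and f: "f \<in> L2_space M"
  shows "f \<in> L2_closure M (range wave)"
proof -
  have waves: "range wave \<subseteq> L2_space M" using wave_L2_space by auto
  have fm: "f \<in> borel_measurable M" and fi: "integrable M (\<lambda>x. (cmod (f x))\<^sup>2)"
    using f by (auto simp: L2_space_def)
  obtain s where s: "\<And>i. simple_function M (s i)" "\<And>x. (\<lambda>i. s i x) \<longlonglongrightarrow> f x"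
    "\<And>i x. cmod (s i x) \<le> 2 * cmod (f x)"
    using borel_measurable_implies_sequence_metric[OF fm, of 0] by auto
  show ?thesis
  proof (rule L2_closure_dominated[OF waves])
    show "s i \<in> L2_closure M (range wave)" for i
    proof -
      have fin: "finite (range (s i))"
        using s(1)[of i] by (simp add: simple_function_def)
      have "s i -` {y} \<in> sets borel" for y
        using borel_measurable_simple_function[OF s(1)[of i]] measurable_sets[of "s i" M borel "{y}"]
        by simp
      then have "(\<lambda>x. \<Sum>y\<in>range (s i). y * indicator (s i -` {y}) x) \<in> L2_closure M (range wave)"
        using indicator_in_wave_closure[OF supp]
        by (intro L2_closure_sum[OF waves] fin L2_closure_scale[OF waves]) auto
      moreover have "(\<lambda>x. \<Sum>y\<in>range (s i). y * indicator (s i -` {y}) x) = s i"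
      proof
        fix x
        have "(\<Sum>y\<in>range (s i). y * indicator (s i -` {y}) x) = (\<Sum>y\<in>range (s i). if y = s i x then y else 0)"
          by (intro sum.cong) (auto simp: indicator_def)
        then show "(\<Sum>y\<in>range (s i). y * indicator (s i -` {y}) x) = s i x"
          using fin by simp
      qed
      ultimately show ?thesis by simp
    qed
    show "integrable M (\<lambda>x. (2 * cmod (f x))\<^sup>2)"
      using fi by (simp add: power_mult_distrib)
  qed (use fm s in auto)
qed

end

section \<open>The self-similar measure and its Fourier transform\<close>

text \<open>Extending \<open>real_distribution\<close> makes the continuity of the characteristic
  function available for \<open>phi\<close>.\<close>

locale cantor4 = real_distribution \<mu> for \<mu> +
  assumes self_similar: "E \<in> sets borel \<Longrightarrow>
    measure \<mu> E = (measure \<mu> (tau 0 -` E) + measure \<mu> (tau 2 -` E)) / 2"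

lemma cantor4_measure_locale:
  assumes "cantor4_measure \<mu>"
  shows "cantor4 \<mu>"
proof -
  interpret prob_space \<mu> using assms by (simp add: cantor4_measure_def)
  show ?thesis
    by unfold_locales (use assms in \<open>auto simp: cantor4_measure_def\<close>)
qed

lemma borel_measurable_tau [measurable]: "tau b \<in> borel_measurable borel"
  unfolding tau_def[abs_def] by measurable

context cantor4
begin

text \<open>Both sides are additive and respect increasing limits in \<open>f\<close>, so the
  identity for indicators extends to all nonnegative measurable functions.\<close>

lemma nn_integral_self_similar:
  assumes "f \<in> borel_measurable borel"
  shows "2 * (\<integral>\<^sup>+x. f x \<partial>\<mu>) = (\<integral>\<^sup>+x. f (tau 0 x) \<partial>\<mu>) + (\<integral>\<^sup>+x. f (tau 2 x) \<partial>\<mu>)"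
  using assms
proof (induction rule: borel_measurable_induct)
  case (cong f g)
  then show ?case by (simp cong: nn_integral_cong)
next
  case (set A)
  have [measurable]: "tau b -` A \<in> sets borel" for b
    using measurable_sets[OF borel_measurable_tau set, of b] by simp
  have ind: "(\<integral>\<^sup>+x. indicator A (tau b x) \<partial>\<mu>) = ennreal (measure \<mu> (tau b -` A))" for b
  proof -
    have "(\<lambda>x. indicator A (tau b x) :: ennreal) = indicator (tau b -` A)"
      by (auto simp: indicator_def)
    then show ?thesis by (simp add: emeasure_eq_measure)
  qed
  have "2 * (\<integral>\<^sup>+x. indicator A x \<partial>\<mu>) = ennreal (2 * measure \<mu> A)"
    using set by (simp add: emeasure_eq_measure ennreal_mult)
  also have "\<dots> = ennreal (measure \<mu> (tau 0 -` A) + measure \<mu> (tau 2 -` A))"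
    using self_similar[OF set] by (simp add: field_simps)
  also have "\<dots> = ennreal (measure \<mu> (tau 0 -` A)) + ennreal (measure \<mu> (tau 2 -` A))"
    by (rule ennreal_plus) auto
  finally show ?case by (simp only: ind)
next
  case (mult u c)
  then show ?case
    by (simp add: nn_integral_cmult distrib_left[symmetric] mult.left_commute[of 2])
next
  case (add u v)
  then show ?case
    by (simp add: nn_integral_add distrib_left ac_simps)
next
  case (seq U)
  have inc: "incseq (\<lambda>i x. U i (tau b x))" for b
    using seq.hyps(3) by (auto simp: incseq_def le_fun_def)
  have [measurable]: "U i \<in> borel_measurable borel" for i by (rule seq.hyps(1))
  have int: "incseq (\<lambda>i. \<integral>\<^sup>+x. U i (tau b x) \<partial>\<mu>)" for b
    using seq.hyps(3) by (auto simp: incseq_def le_fun_def intro!: nn_integral_mono)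
  have "2 * (\<integral>\<^sup>+x. (SUP i. U i) x \<partial>\<mu>) = (SUP i. 2 * (\<integral>\<^sup>+x. U i x \<partial>\<mu>))"
    unfolding SUP_apply using seq.hyps(3)
    by (subst nn_integral_monotone_convergence_SUP) (auto simp: SUP_mult_left_ennreal)
  also have "\<dots> = (SUP i. (\<integral>\<^sup>+x. U i (tau 0 x) \<partial>\<mu>) + (\<integral>\<^sup>+x. U i (tau 2 x) \<partial>\<mu>))"
    by (simp add: seq.IH)
  also have "\<dots> = (SUP i. \<integral>\<^sup>+x. U i (tau 0 x) \<partial>\<mu>) + (SUP i. \<integral>\<^sup>+x. U i (tau 2 x) \<partial>\<mu>)"
    by (rule ennreal_SUP_add[OF int int])
  also have "\<dots> = (\<integral>\<^sup>+x. (SUP i. U i) (tau 0 x) \<partial>\<mu>) + (\<integral>\<^sup>+x. (SUP i. U i) (tau 2 x) \<partial>\<mu>)"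
    unfolding SUP_apply by (simp add: nn_integral_monotone_convergence_SUP[OF inc])
  finally show ?case .
qed

lemma integrable_bounded:
  fixes f :: "real \<Rightarrow> 'b :: {banach, second_countable_topology}"
  assumes "f \<in> borel_measurable borel" "\<And>x. norm (f x) \<le> B"
  shows "integrable \<mu> f"
  using assms by (intro integrable_const_bound[of _ B]) auto

lemma integral_self_similar_real:
  fixes f :: "real \<Rightarrow> real"
  assumes [measurable]: "f \<in> borel_measurable borel" and f1: "\<And>x. \<bar>f x\<bar> \<le> 1"
  shows "2 * (\<integral>x. f x \<partial>\<mu>) = (\<integral>x. f (tau 0 x) \<partial>\<mu>) + (\<integral>x. f (tau 2 x) \<partial>\<mu>)"
proof -
  \<comment> \<open>Adding 1 makes a function bounded by 1 nonnegative, so the identity for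
    nonnegative integrals applies. The constants cancel at the end because the measure has mass
    1.\<close>
  have eq: "(\<integral>\<^sup>+x. ennreal (1 + g x) \<partial>\<mu>) = ennreal (1 + (\<integral>x. g x \<partial>\<mu>))"
    and nn: "0 \<le> 1 + (\<integral>x. g x \<partial>\<mu>)"
    if [measurable]: "g \<in> borel_measurable borel" and g1: "\<And>x. \<bar>g x\<bar> \<le> 1" for g
  proof -
    have g: "integrable \<mu> g" using that by (intro integrable_bounded[where B = 1]) auto
    have pos: "0 \<le> 1 + g x" for x using g1[of x] by linarith
    have *: "(\<integral>x. 1 + g x \<partial>\<mu>) = 1 + (\<integral>x. g x \<partial>\<mu>)"
      using g by (simp add: prob_space del: space_eq_univ)
    show "(\<integral>\<^sup>+x. ennreal (1 + g x) \<partial>\<mu>) = ennreal (1 + (\<integral>x. g x \<partial>\<mu>))"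
      using g pos by (subst nn_integral_eq_integral) (auto simp: *[symmetric])
    show "0 \<le> 1 + (\<integral>x. g x \<partial>\<mu>)"
      unfolding *[symmetric] by (intro integral_nonneg_AE) (simp add: pos)
  qed
  have "2 * ennreal (1 + (\<integral>x. f x \<partial>\<mu>)) = ennreal (1 + (\<integral>x. f (tau 0 x) \<partial>\<mu>)) + ennreal (1 + (\<integral>x. f (tau 2 x) \<partial>\<mu>))"
    using nn_integral_self_similar[of "\<lambda>x. ennreal (1 + f x)"] f1 by (simp add: eq)
  also have "2 * ennreal (1 + (\<integral>x. f x \<partial>\<mu>)) = ennreal (2 * (1 + (\<integral>x. f x \<partial>\<mu>)))"
    using nn[OF assms] by (subst ennreal_mult) auto
  also have "ennreal (1 + (\<integral>x. f (tau 0 x) \<partial>\<mu>)) + ennreal (1 + (\<integral>x. f (tau 2 x) \<partial>\<mu>))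
      = ennreal ((1 + (\<integral>x. f (tau 0 x) \<partial>\<mu>)) + (1 + (\<integral>x. f (tau 2 x) \<partial>\<mu>)))"
    using nn[of "\<lambda>x. f (tau 0 x)"] nn[of "\<lambda>x. f (tau 2 x)"] f1 by (intro ennreal_plus[symmetric]) auto
  finally show ?thesis
    using nn[OF assms] nn[of "\<lambda>x. f (tau 0 x)"] nn[of "\<lambda>x. f (tau 2 x)"] f1
    by (subst (asm) ennreal_inj) auto
qed

lemma integral_self_similar:
  fixes f :: "real \<Rightarrow> complex"
  assumes [measurable]: "f \<in> borel_measurable borel" and f1: "\<And>x. cmod (f x) \<le> 1"
  shows "2 * (\<integral>x. f x \<partial>\<mu>) = (\<integral>x. f (tau 0 x) \<partial>\<mu>) + (\<integral>x. f (tau 2 x) \<partial>\<mu>)"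
proof -
  have int: "integrable \<mu> f" "integrable \<mu> (\<lambda>x. f (tau b x))" for b
    using f1 by (auto intro!: integrable_bounded[where B = 1])
  have "\<bar>Re (f x)\<bar> \<le> 1" "\<bar>Im (f x)\<bar> \<le> 1" for x
    using abs_Re_le_cmod[of "f x"] abs_Im_le_cmod[of "f x"] f1[of x] by linarith+
  then show ?thesis
    using integral_self_similar_real[of "\<lambda>x. Re (f x)"] integral_self_similar_real[of "\<lambda>x. Im (f x)"]
    by (simp add: complex_eq_iff int)
qed

definition phi :: "real \<Rightarrow> complex" where
  "phi t = (\<integral>x. wave t x \<partial>\<mu>)"

lemma integrable_wave [simp]: "integrable \<mu> (wave t)"
  by (rule integrable_bounded[where B = 1]) auto

lemma phi_0 [simp]: "phi 0 = 1"
  by (simp add: phi_def prob_space del: space_eq_univ)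

lemma phi_minus: "phi (- t) = cnj (phi t)"
proof -
  have "wave (- t) = (\<lambda>x. cnj (wave t x))" by (simp add: fun_eq_iff cnj_wave)
  then show ?thesis by (simp add: phi_def)
qed

text \<open>Both contractions turn \<open>wave s\<close> into \<open>wave (s / 4)\<close>; the
  translation in \<open>tau 2\<close> adds the phase \<open>cis (pi * s)\<close>.\<close>

lemma phi_refine: "phi s = phi (s / 4) * ((1 + cis (pi * s)) / 2)"
proof -
  have "wave s (tau 0 x) = wave (s / 4) x" "wave s (tau 2 x) = cis (pi * s) * wave (s / 4) x" for x
    by (simp_all add: wave_def tau_def cis_mult algebra_simps add_divide_distrib)
  then have "2 * phi s = phi (s / 4) + cis (pi * s) * phi (s / 4)"
    unfolding phi_def by (subst integral_self_similar) auto
  then show ?thesis by (simp add: algebra_simps)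
qed

lemma cis_pi_int: "cis (pi * of_int n) = (if even n then 1 else - 1)"
proof (cases "even n")
  case True
  then obtain k where "n = 2 * k" by (rule evenE)
  then show ?thesis using cis_multiple_2pi[of "of_int k"] by (simp add: ac_simps)
next
  case False
  then obtain k where k: "n = 2 * k + 1" by (rule oddE)
  have "pi * of_int n = 2 * pi * of_int k + pi" by (simp add: k algebra_simps)
  then show ?thesis using False cis_multiple_2pi[of "of_int k"] by (simp flip: cis_mult)
qed

lemma phi_odd: "odd n \<Longrightarrow> phi (of_int n) = 0"
  using phi_refine[of "of_int n"] by (simp add: cis_pi_int)

lemma phi_mult_4: "phi (4 * of_int n) = phi (of_int n)"
  using phi_refine[of "of_int (4 * n)"] cis_pi_int[of "4 * n"] by simp

lemma isCont_phi: "isCont phi t"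
proof -
  have "phi = (\<lambda>t. char \<mu> (2 * pi * t))"
    by (auto simp: phi_def char_def wave_def cis_conv_exp fun_eq_iff)
  then show ?thesis
    by (simp only:) (rule isCont_o2[OF _ isCont_char], intro continuous_intros)
qed

lemma continuous_on_phi: "continuous_on A phi"
  by (simp add: continuous_at_imp_continuous_on isCont_phi)

text \<open>A point outside the \<open>\<delta>\<close>-neighbourhood of the unit interval that is
  the image of some \<open>x\<close> under a contraction forces \<open>x\<close> outside the
  \<open>4 * \<delta>\<close>-neighbourhood. Iterating bounds the outside mass by that of sets
  shrinking to the empty set.\<close>

lemma support: "AE x in \<mu>. x \<in> {0..1}"
proof -
  define D where "D \<delta> = - {- \<delta>..1 + \<delta>}" for \<delta> :: real
  have [measurable]: "D \<delta> \<in> sets borel" for \<delta> by (simp add: D_def)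
  have step: "measure \<mu> (D \<delta>) \<le> measure \<mu> (D (4 * \<delta>))" if "\<delta> \<ge> 0" for \<delta>
  proof -
    have "measure \<mu> (tau 0 -` D \<delta>) \<le> measure \<mu> (D (4 * \<delta>))" "measure \<mu> (tau 2 -` D \<delta>) \<le> measure \<mu> (D (4 * \<delta>))"
      using that by (auto intro!: finite_measure_mono simp: D_def tau_def field_simps)
    then show ?thesis by (simp add: self_similar[of "D \<delta>"])
  qed
  have "measure \<mu> (D \<delta>) = 0" if "\<delta> > 0" for \<delta>
  proof -
    have le: "measure \<mu> (D \<delta>) \<le> measure \<mu> (D (4 ^ n * \<delta>))" for n
    proof (induction n)
      case (Suc n)
      also have "measure \<mu> (D (4 ^ n * \<delta>)) \<le> measure \<mu> (D (4 * (4 ^ n * \<delta>)))"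
        using that by (intro step) simp
      finally show ?case by (simp add: mult.assoc)
    qed simp
    have "decseq (\<lambda>n. D (4 ^ n * \<delta>))"
    proof (rule decseq_SucI)
      fix n :: nat
      have "4 ^ n * \<delta> \<le> 4 ^ Suc n * \<delta>" using that by simp
      then show "D (4 ^ Suc n * \<delta>) \<subseteq> D (4 ^ n * \<delta>)" by (auto simp: D_def)
    qed
    then have "(\<lambda>n. measure \<mu> (D (4 ^ n * \<delta>))) \<longlonglongrightarrow> measure \<mu> (\<Inter>n. D (4 ^ n * \<delta>))"
      by (intro finite_Lim_measure_decseq) auto
    moreover have "(\<Inter>n. D (4 ^ n * \<delta>)) = {}"
    proof -
      have "\<exists>n. x \<notin> D (4 ^ n * \<delta>)" for x
      proof -
        obtain n where "\<bar>x\<bar> / \<delta> < 4 ^ n" using real_arch_pow[of 4 "\<bar>x\<bar> / \<delta>"] by auto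
        then have "\<bar>x\<bar> < 4 ^ n * \<delta>" using that by (simp add: field_simps)
        then show ?thesis by (intro exI[of _ n]) (auto simp: D_def)
      qed
      then show ?thesis by blast
    qed
    ultimately have "measure \<mu> (D \<delta>) \<le> 0"
      using le by (intro LIMSEQ_le_const[of "\<lambda>n. measure \<mu> (D (4 ^ n * \<delta>))"]) auto
    then show ?thesis by (simp add: measure_le_0_iff)
  qed
  then have "AE x in \<mu>. x \<notin> D (1 / Suc k)" for k
    by (intro AE_not_in) (auto simp: null_sets_def emeasure_eq_measure)
  then have "AE x in \<mu>. \<forall>k. x \<notin> D (1 / Suc k)" by (simp add: AE_all_countable)
  then show ?thesis
  proof eventually_elim
    case (elim x)
    have "- x \<le> 0 + e" "x \<le> 1 + e" if e: "e > 0" for e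
    proof -
      obtain k where "1 / real (Suc k) < e" by (rule nat_approx_posE[OF e])
      moreover have "- (1 / Suc k) \<le> x" "x \<le> 1 + 1 / Suc k" using elim by (auto simp: D_def)
      ultimately show "- x \<le> 0 + e" "x \<le> 1 + e" by linarith+
    qed
    from field_le_epsilon[OF this(1)] field_le_epsilon[OF this(2)] show ?case by simp
  qed
qed


text \<open>Pythagoras: \<open>phi (s - a)\<close> is the inner product of \<open>wave s\<close>
  with \<open>wave a\<close>, so the subtracted sum is the orthogonal projection onto the span of an
  orthonormal family.\<close>

lemma integral_wave_minus_sum:
  assumes fin: "finite G" and orth: "\<And>a b. a \<in> G \<Longrightarrow> b \<in> G \<Longrightarrow> a \<noteq> b \<Longrightarrow> phi (a - b) = 0"
  shows "(\<integral>x. (cmod (wave s x - (\<Sum>a\<in>G. phi (s - a) * wave a x)))\<^sup>2 \<partial>\<mu>) = 1 - (\<Sum>a\<in>G. (cmod (phi (s - a)))\<^sup>2)"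
proof -
  define c where "c a = phi (s - a)" for a
  have cc: "cnj (c a) = phi (a - s)" for a
    using phi_minus[of "s - a"] by (simp add: c_def)
  have sq: "c a * phi (a - s) = (cmod (c a))\<^sup>2" for a
    by (simp add: complex_norm_square flip: cc del: of_real_power)
  \<comment> \<open>The square is written as a product with its conjugate and multiplied out, so
    that each term integrates to a value of \<open>phi\<close>.\<close>
  have exp: "complex_of_real ((cmod (wave s x - (\<Sum>a\<in>G. c a * wave a x)))\<^sup>2) =
      1 - (\<Sum>a\<in>G. phi (a - s) * wave (s - a) x) - (\<Sum>a\<in>G. c a * wave (a - s) x)
        + (\<Sum>a\<in>G. \<Sum>b\<in>G. c a * phi (b - s) * wave (a - b) x)" for x
  proof -
    have w: "wave a x * wave (- b) x = wave (a - b) x" for a b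
      by (simp add: wave_mult)
    have "complex_of_real ((cmod (wave s x - (\<Sum>a\<in>G. c a * wave a x)))\<^sup>2) =
        (wave s x - (\<Sum>a\<in>G. c a * wave a x)) * (wave (- s) x - (\<Sum>a\<in>G. phi (a - s) * wave (- a) x))"
      by (simp only: complex_norm_square complex_cnj_diff cnj_sum complex_cnj_mult cc cnj_wave)
    also have "\<dots> = wave s x * wave (- s) x - (\<Sum>a\<in>G. phi (a - s) * (wave s x * wave (- a) x))
        - (\<Sum>a\<in>G. c a * (wave a x * wave (- s) x))
        + (\<Sum>a\<in>G. \<Sum>b\<in>G. c a * phi (b - s) * (wave a x * wave (- b) x))"
    proof -
      have mult_diff: "(u - v) * (w - z) = u * w - u * z - v * w + v * z" for u v w z :: complex
        by (simp add: algebra_simps)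
      show ?thesis
        unfolding mult_diff by (simp add: sum_distrib_left sum_distrib_right sum_product ac_simps)
          (rule sum.swap)
    qed
    finally show ?thesis by (simp add: w)
  qed
  have "complex_of_real (\<integral>x. (cmod (wave s x - (\<Sum>a\<in>G. c a * wave a x)))\<^sup>2 \<partial>\<mu>) =
      (\<integral>x. complex_of_real ((cmod (wave s x - (\<Sum>a\<in>G. c a * wave a x)))\<^sup>2) \<partial>\<mu>)"
    by (rule integral_complex_of_real[symmetric])
  also have "\<dots> = 1 - (\<Sum>a\<in>G. phi (a - s) * phi (s - a)) - (\<Sum>a\<in>G. c a * phi (a - s))
        + (\<Sum>a\<in>G. \<Sum>b\<in>G. c a * phi (b - s) * phi (a - b))"
    unfolding exp by (simp add: phi_def[symmetric] prob_space del: space_eq_univ)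
  also have "(\<Sum>a\<in>G. \<Sum>b\<in>G. c a * phi (b - s) * phi (a - b)) = (\<Sum>a\<in>G. c a * phi (a - s))"
  proof (intro sum.cong refl)
    fix a assume "a \<in> G"
    then have "(\<Sum>b\<in>G. c a * phi (b - s) * phi (a - b)) = (\<Sum>b\<in>G. if b = a then c a * phi (a - s) else 0)"
      using orth by (intro sum.cong) auto
    then show "(\<Sum>b\<in>G. c a * phi (b - s) * phi (a - b)) = c a * phi (a - s)"
      using fin \<open>a \<in> G\<close> by simp
  qed
  also have "1 - (\<Sum>a\<in>G. phi (a - s) * phi (s - a)) - (\<Sum>a\<in>G. c a * phi (a - s)) + (\<Sum>a\<in>G. c a * phi (a - s))
     = 1 - (\<Sum>a\<in>G. c a * phi (a - s))"
    by (simp add: c_def mult.commute)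
  also have "\<dots> = complex_of_real (1 - (\<Sum>a\<in>G. (cmod (c a))\<^sup>2))"
    by (simp add: sq)
  finally show ?thesis unfolding of_real_eq_iff by (simp add: c_def)
qed

end

section \<open>Finite levels of Gamma(m) and their orthogonality\<close>

text \<open>Elements with \<open>N\<close> base 4 digits from \<open>{0, m}\<close>. The recursion
  attaches the lowest digit, which fits the division by 4 in \<open>phi_refine\<close>. The case
  \<open>m = 1\<close> will also encode the digit sequences of cycles.\<close>

fun level :: "nat \<Rightarrow> nat \<Rightarrow> nat set" where
  "level m 0 = {0}"
| "level m (Suc N) = (\<lambda>a. 4 * a) ` level m N \<union> (\<lambda>a. m + 4 * a) ` level m N"

lemma level_SucD: "a \<in> level m (Suc N) \<Longrightarrow> \<exists>b d. b \<in> level m N \<and> d \<in> {0, m} \<and> a = d + 4 * b"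
  by force

lemma finite_level [simp]: "finite (level m N)"
  by (induction N) auto

text \<open>A leading zero changes nothing; since the recursion works at the lowest digit, this
  takes an induction starting from \<open>0 = 4 * 0\<close>.\<close>

lemma level_Suc_mono: "level m N \<subseteq> level m (Suc N)"
proof (induction N)
  case (Suc N)
  then have "(\<lambda>a. 4 * a) ` level m N \<subseteq> (\<lambda>a. 4 * a) ` level m (Suc N)"
    "(\<lambda>a. m + 4 * a) ` level m N \<subseteq> (\<lambda>a. m + 4 * a) ` level m (Suc N)"
    by (intro image_mono, assumption)+
  then show ?case by (simp only: level.simps(2)[of m "Suc N"] level.simps(2)[of m N]) blast
qed simp

lemma level_mono: "N \<le> N' \<Longrightarrow> level m N \<subseteq> level m N'"
  by (rule lift_Suc_mono_le[of "level m"]) (rule level_Suc_mono)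

lemma Gamma_set_eq_level: "Gamma_set m = (\<Union>N. level m N)"
proof (intro equalityI subsetI)
  fix a assume "a \<in> Gamma_set m"
  then obtain n l where a: "a = (\<Sum>k\<le>n. 4 ^ k * l k)" and l: "\<forall>k\<le>n. l k \<in> {0, m}"
    unfolding Gamma_set_def by blast
  \<comment> \<open>The indices 0 to \<open>n\<close> give \<open>n + 1\<close> digits.\<close>
  from l have "(\<Sum>k\<le>n. 4 ^ k * l k) \<in> level m (Suc n)"
  proof (induction n arbitrary: l)
    case 0
    then show ?case by auto
  next
    case (Suc n)
    have "(\<Sum>k\<le>Suc n. 4 ^ k * l k) = l 0 + 4 * (\<Sum>k\<le>n. 4 ^ k * l (Suc k))"
      by (subst sum.atMost_Suc_shift) (simp add: sum_distrib_left mult.assoc)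
    moreover have "(\<Sum>k\<le>n. 4 ^ k * l (Suc k)) \<in> level m (Suc n)"
      using Suc.prems by (intro Suc.IH) auto
    moreover have "l 0 \<in> {0, m}" using Suc.prems by blast
    ultimately show ?case unfolding level.simps(2)[of m "Suc n"] by (auto simp del: level.simps)
  qed
  then show "a \<in> (\<Union>N. level m N)" unfolding a by blast
next
  fix a assume "a \<in> (\<Union>N. level m N)"
  then obtain N where "a \<in> level m N" by blast
  then show "a \<in> Gamma_set m"
  proof (induction N arbitrary: a)
    case 0
    then show ?case unfolding Gamma_set_def by (auto intro!: exI[of _ 0] exI[of _ "\<lambda>_. 0"])
  next
    case (Suc N)
    then obtain b d where b: "b \<in> level m N" and d: "d \<in> {0, m}" and a: "a = d + 4 * b"
      using level_SucD[OF Suc.prems] by blast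
    from Suc.IH[OF b] obtain n l where
      bl: "b = (\<Sum>k\<le>n. 4 ^ k * l k)" and l: "\<forall>k\<le>n. l k \<in> {0, m}"
      unfolding Gamma_set_def by blast
    define l' where "l' k = (case k of 0 \<Rightarrow> d | Suc k \<Rightarrow> l k)" for k
    have "a = (\<Sum>k\<le>Suc n. 4 ^ k * l' k)"
      unfolding a bl by (subst sum.atMost_Suc_shift) (simp add: l'_def sum_distrib_left mult.assoc)
    moreover have "\<forall>k\<le>Suc n. l' k \<in> {0, m}"
      using l d by (auto simp: l'_def split: nat.splits)
    ultimately show ?case unfolding Gamma_set_def by blast
  qed
qed

text \<open>The two images are disjoint by parity, as \<open>m\<close> is odd.\<close>

lemma sum_level_Suc:
  fixes f :: "nat \<Rightarrow> 'a :: comm_monoid_add"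
  assumes "odd m"
  shows "sum f (level m (Suc N)) = (\<Sum>a\<in>level m N. f (4 * a)) + (\<Sum>a\<in>level m N. f (m + 4 * a))"
proof -
  have disj: "(\<lambda>a. 4 * a) ` level m N \<inter> (\<lambda>a. m + 4 * a) ` level m N = {}"
  proof safe
    fix a b assume "4 * a = m + 4 * b"
    then have "even (m + 4 * b)" by (metis even_mult_iff even_numeral)
    then show "4 * a \<in> {}" using assms by simp
  qed
  then show ?thesis
    by (simp add: sum.union_disjoint sum.reindex inj_on_def)
qed

context cantor4
begin

lemma expo_eq_wave: "expo l = wave (real l)"
  by (auto simp: expo_def wave_def cis_conv_exp fun_eq_iff ac_simps)

text \<open>Compare lowest digits. If they differ, the difference is odd and \<open>phi\<close>
  vanishes there; if they agree, it is a multiple of 4 and the digit can be removed.\<close>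

lemma level_orthogonal:
  assumes "odd m" "a \<in> level m N" "b \<in> level m N" "a \<noteq> b"
  shows "phi (real a - real b) = 0"
  using assms(2-)
proof (induction N arbitrary: a b)
  case (Suc N)
  obtain a' c where a: "a' \<in> level m N" "c \<in> {0, m}" "a = c + 4 * a'"
    using level_SucD[OF Suc.prems(1)] by blast
  obtain b' d where b: "b' \<in> level m N" "d \<in> {0, m}" "b = d + 4 * b'"
    using level_SucD[OF Suc.prems(2)] by blast
  show ?case
  proof (cases "c = d")
    case True
    then have "real a - real b = 4 * of_int (int a' - int b')" using a b by simp
    moreover have "phi (real a' - real b') = 0" using Suc a b True by auto
    ultimately show ?thesis using phi_mult_4[of "int a' - int b'"] by simp
  next
    case False
    then have "odd (int a - int b)" using a b \<open>odd m\<close> by auto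
    from phi_odd[OF this] show ?thesis by simp
  qed
qed simp

lemma L2_inner_wave: "L2_inner \<mu> (wave s) (wave t) = phi (s - t)"
  unfolding L2_inner_def by (simp add: cnj_wave wave_mult phi_def)

text \<open>For odd \<open>m\<close> the exponentials are orthonormal by
  \<open>level_orthogonal\<close>, which leaves density to be decided.\<close>

lemma complete_number_iff_dense:
  assumes "odd m"
  shows "complete_number \<mu> m \<longleftrightarrow> L2_space \<mu> \<subseteq> L2_closure \<mu> (expo ` Gamma_set m)"
proof -
  let ?B = "expo ` Gamma_set m"
  have sub: "?B \<subseteq> L2_space \<mu>" by (auto simp: expo_eq_wave wave_L2_space)
  have orth: "L2_inner \<mu> f g = (if AE x in \<mu>. f x = g x then 1 else 0)" if fg: "f \<in> ?B" "g \<in> ?B" for f g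
  proof -
    obtain a b where a: "a \<in> Gamma_set m" "f = wave (real a)" and b: "b \<in> Gamma_set m" "g = wave (real b)"
      using fg by (auto simp: expo_eq_wave)
    have inner: "L2_inner \<mu> f g = (if a = b then 1 else 0)"
    proof (cases "a = b")
      case False
      obtain N N' where "a \<in> level m N" "b \<in> level m N'"
        using a b by (auto simp: Gamma_set_eq_level)
      then have "a \<in> level m (max N N')" "b \<in> level m (max N N')"
        using level_mono[of N "max N N'" m] level_mono[of N' "max N N'" m] by auto
      from level_orthogonal[OF assms this False] show ?thesis
        using False by (simp add: a b L2_inner_wave)
    qed (simp add: a b L2_inner_wave)
    \<comment> \<open>Distinct frequencies give distinct classes: almost everywhere equal
      exponentials would have inner product 1, not 0.\<close>
    have "(AE x in \<mu>. f x = g x) \<longleftrightarrow> a = b"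
    proof
      assume "AE x in \<mu>. f x = g x"
      then have "L2_inner \<mu> f g = L2_inner \<mu> g g"
        unfolding L2_inner_def a b cnj_wave by (intro integral_cong_AE) (auto elim: eventually_mono)
      also have "\<dots> = 1" by (simp add: b L2_inner_wave)
      finally show "a = b" using inner by (auto split: if_splits)
    qed (simp add: a b)
    with inner show ?thesis by simp
  qed
  have sqrt_lt: "sqrt (\<integral>x. (cmod (f x - g x))\<^sup>2 \<partial>\<mu>) < \<epsilon> \<longleftrightarrow> (\<integral>x. (cmod (f x - g x))\<^sup>2 \<partial>\<mu>) < \<epsilon>\<^sup>2"
    if "\<epsilon> > 0" for f g and \<epsilon> :: real
    using that real_sqrt_less_iff[of _ "\<epsilon>\<^sup>2"] by (auto simp: real_sqrt_abs)
  have dense: "(\<forall>\<epsilon>>0. \<exists>S c. finite S \<and> S \<subseteq> ?B \<and> L2_norm \<mu> (\<lambda>x. f x - (\<Sum>e\<in>S. c e * e x)) < \<epsilon>) \<longleftrightarrow>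
      f \<in> L2_closure \<mu> ?B" if f: "f \<in> L2_space \<mu>" for f
  proof
    assume L: "\<forall>\<epsilon>>0. \<exists>S c. finite S \<and> S \<subseteq> ?B \<and> L2_norm \<mu> (\<lambda>x. f x - (\<Sum>e\<in>S. c e * e x)) < \<epsilon>"
    show "f \<in> L2_closure \<mu> ?B"
      unfolding L2_closure_def
    proof (intro CollectI conjI f allI impI)
      fix \<epsilon> :: real assume "\<epsilon> > 0"
      then obtain S c where S: "finite S" "S \<subseteq> ?B" "L2_norm \<mu> (\<lambda>x. f x - (\<Sum>e\<in>S. c e * e x)) < sqrt \<epsilon>"
        using L by (meson real_sqrt_gt_zero)
      have "(\<integral>x. (cmod (f x - (\<Sum>e\<in>S. c e * e x)))\<^sup>2 \<partial>\<mu>) < \<epsilon>"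
        using S(3) by (simp add: L2_norm_def)
      moreover have "(\<lambda>x. \<Sum>e\<in>S. c e * e x) \<in> cspan ?B"
        using S by (intro cspan_sum cspan_scale cspan_superset) auto
      ultimately show "\<exists>g\<in>cspan ?B. (\<integral>x. (cmod (f x - g x))\<^sup>2 \<partial>\<mu>) < \<epsilon>"
        by (rule bexI[of _ "\<lambda>x. \<Sum>e\<in>S. c e * e x"])
    qed
  next
    assume L: "f \<in> L2_closure \<mu> ?B"
    show "\<forall>\<epsilon>>0. \<exists>S c. finite S \<and> S \<subseteq> ?B \<and> L2_norm \<mu> (\<lambda>x. f x - (\<Sum>e\<in>S. c e * e x)) < \<epsilon>"
    proof (intro allI impI)
      fix \<epsilon> :: real assume "\<epsilon> > 0"
      then obtain g where g: "g \<in> cspan ?B" "(\<integral>x. (cmod (f x - g x))\<^sup>2 \<partial>\<mu>) < \<epsilon>\<^sup>2"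
        using L unfolding L2_closure_def by (auto dest!: spec[of _ "\<epsilon>\<^sup>2"])
      from cspan_explicit[OF g(1)] obtain S c where S: "finite S" "S \<subseteq> ?B" "g = (\<lambda>x. \<Sum>e\<in>S. c e * e x)"
        by blast
      have "L2_norm \<mu> (\<lambda>x. f x - g x) < \<epsilon>"
        using g(2) \<open>\<epsilon> > 0\<close> unfolding L2_norm_def by (simp add: sqrt_lt)
      then show "\<exists>S c. finite S \<and> S \<subseteq> ?B \<and> L2_norm \<mu> (\<lambda>x. f x - (\<Sum>e\<in>S. c e * e x)) < \<epsilon>"
        using S by blast
    qed
  qed
  have "complete_number \<mu> m \<longleftrightarrow> (\<forall>f\<in>L2_space \<mu>. f \<in> L2_closure \<mu> ?B)"
    unfolding complete_number_def orthonormal_basis_L2_def using sub orth dense by (simp cong: ball_cong)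
  then show ?thesis by (simp only: subset_eq)
qed

end

section \<open>Extreme cycles\<close>

text \<open>The points of an extreme cycle satisfy \<open>2 x\<^sub>k \<in> \<int>\<close>, and \<open>4 x\<^sub>k\<^sub>+\<^sub>1 - x\<^sub>k\<close> is an integer, so
  \<open>x\<^sub>k\<close> is one as well. Only cycles avoiding \<open>0\<close> are considered.\<close>

definition extreme_cycle :: "nat \<Rightarrow> nat \<Rightarrow> (nat \<Rightarrow> int) \<Rightarrow> bool" where
  "extreme_cycle m r x \<longleftrightarrow> r > 0 \<and> (\<forall>k. x (k + r) = x k) \<and> (\<forall>k. x k \<noteq> 0) \<and>
     (\<forall>k. 4 * x (Suc k) - x k \<in> {0, int m})"

section \<open>Bounds, counting and divisibility for cycle points\<close>

text \<open>Unrolls \<open>n\<close> steps. The digits divided by \<open>m\<close> are 0 or 1 and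
  assemble to the base 4 number \<open>a\<close>.\<close>

lemma extreme_cycle_iterate:
  assumes "extreme_cycle m r x"
  shows "\<exists>a\<in>level 1 n. 4 ^ n * x (k + n) = x k + int m * int a"
proof (induction n arbitrary: k)
  case (Suc n)
  obtain a where a: "a \<in> level 1 n" "4 ^ n * x (Suc k + n) = x (Suc k) + int m * int a"
    using Suc[of "Suc k"] by blast
  obtain d :: nat where d: "d \<in> {0, 1}" "4 * x (Suc k) = x k + int m * int d"
  proof -
    have "4 * x (Suc k) - x k \<in> {0, int m}" using assms by (simp add: extreme_cycle_def)
    then show ?thesis by (auto intro: that[of 0] that[of 1])
  qed
  have "4 ^ Suc n * x (k + Suc n) = 4 * (4 ^ n * x (Suc k + n))" by simp
  also have "\<dots> = 4 * x (Suc k) + 4 * int m * int a" unfolding a by simp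
  also have "\<dots> = x k + int m * int (d + 4 * a)" unfolding d by (simp add: algebra_simps)
  finally show ?case using a(1) d(1) by (intro bexI[of _ "d + 4 * a"]) auto
qed simp

text \<open>The largest element has all digits 1 and equals \<open>(4 ^ n - 1) / 3\<close>.\<close>

lemma level_1_bound: "a \<in> level 1 n \<Longrightarrow> 3 * a + 1 \<le> 4 ^ n"
proof (induction n arbitrary: a)
  case (Suc n)
  from level_SucD[OF Suc.prems] obtain b d where b: "b \<in> level 1 n" "d \<in> {0, 1}" "a = d + 4 * b"
    by blast
  from Suc.IH[OF b(1)] b(2,3) show ?case by auto
qed simp

lemma card_level_le: "card (level m n) \<le> 2 ^ n"
proof (induction n)
  case (Suc n)
  have "card (level m (Suc n)) \<le> card ((\<lambda>a. 4 * a) ` level m n) + card ((\<lambda>a. m + 4 * a) ` level m n)"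
    unfolding level.simps by (rule card_Un_le)
  also have "\<dots> \<le> card (level m n) + card (level m n)"
    by (intro add_mono card_image_le) auto
  finally show ?case using Suc by simp
qed simp

text \<open>Unrolling a whole period gives \<open>(4 ^ r - 1) * x k = m * a\<close> with
  \<open>0 \<le> 3 * a \<le> 4 ^ r - 1\<close>.\<close>

lemma extreme_cycle_bounds:
  assumes "extreme_cycle m r x"
  shows "0 < x k" and "3 * x k \<le> int m"
proof -
  obtain a where a: "a \<in> level 1 r" "4 ^ r * x (k + r) = x k + int m * int a"
    using extreme_cycle_iterate[OF assms] by blast
  have r: "r > 0" "x (k + r) = x k" "x k \<noteq> 0" using assms by (auto simp: extreme_cycle_def)
  define q :: int where "q = 4 ^ r - 1"
  have "(4::int) ^ 1 \<le> 4 ^ r" using r by (intro power_increasing) auto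
  then have q: "q > 0" by (simp add: q_def)
  have eq: "q * x k = int m * int a" using a(2) r(2) by (simp add: q_def algebra_simps)
  then have "0 \<le> q * x k" by simp
  then have "0 \<le> x k" using q by (simp add: zero_le_mult_iff)
  then show "0 < x k" using r by simp
  have "int (3 * a + 1) \<le> int (4 ^ r)" using level_1_bound[OF a(1)] by (simp only: of_nat_le_iff)
  then have "3 * int a \<le> q" by (simp add: q_def)
  then have "int m * (3 * int a) \<le> int m * q" by (intro mult_left_mono) auto
  then have "q * (3 * x k) \<le> q * int m" using eq by (simp add: algebra_simps)
  then show "3 * x k \<le> int m" using q by simp
qed

text \<open>Excluding the left end point is essential for the bound: a closed interval of integer
  length \<open>L\<close> can contain \<open>L + 1\<close> integers.\<close>

lemma card_int_half_open_le:
  assumes "L \<ge> 0"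
  shows "finite {y::int. u < of_int y \<and> of_int y \<le> u + L}"
    and "int (card {y::int. u < of_int y \<and> of_int y \<le> u + L}) \<le> \<lceil>L::real\<rceil>"
proof -
  have sub: "{y::int. u < of_int y \<and> of_int y \<le> u + L} \<subseteq> {\<lfloor>u\<rfloor> + 1..\<lfloor>u\<rfloor> + \<lceil>L\<rceil>}"
  proof
    fix y :: int assume "y \<in> {y. u < of_int y \<and> of_int y \<le> u + L}"
    moreover have "u < of_int \<lfloor>u\<rfloor> + 1" "of_int \<lfloor>u\<rfloor> \<le> u" "L \<le> of_int \<lceil>L\<rceil>" by linarith+
    ultimately have "of_int \<lfloor>u\<rfloor> < (of_int y :: real)" "of_int y < (of_int (\<lfloor>u\<rfloor> + \<lceil>L\<rceil> + 1) :: real)"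
      unfolding mem_Collect_eq of_int_add of_int_1 by linarith+
    then show "y \<in> {\<lfloor>u\<rfloor> + 1..\<lfloor>u\<rfloor> + \<lceil>L\<rceil>}" unfolding of_int_less_iff by simp
  qed
  then show "finite {y::int. u < of_int y \<and> of_int y \<le> u + L}"
    by (rule finite_subset) simp
  have "0 \<le> \<lceil>L\<rceil>" using assms by (simp add: le_ceiling_iff)
  then show "int (card {y::int. u < of_int y \<and> of_int y \<le> u + L}) \<le> \<lceil>L\<rceil>"
    using card_mono[OF _ sub] le_nat_iff by simp
qed

text \<open>Each point has the form \<open>(m * a + x k') / 4 ^ n\<close>, where \<open>a\<close>
  has at most \<open>2 ^ n\<close> possible values and \<open>x k'\<close> lies in the half-open
  interval from 0 to \<open>m / 3\<close>.\<close>

lemma card_extreme_cycle_le: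
  assumes cyc: "extreme_cycle m r x"
  shows "finite (range x)" "int (card (range x)) \<le> 2 ^ n * \<lceil>real m / (3 * 4 ^ n)\<rceil>"
proof -
  define L where "L = real m / (3 * 4 ^ n)"
  define I where "I a = {y::int. real m * real a / 4 ^ n < of_int y \<and> of_int y \<le> real m * real a / 4 ^ n + L}" for a
  have L: "L \<ge> 0" by (simp add: L_def)
  have fin: "finite (\<Union>a\<in>level 1 n. I a)" unfolding I_def by (auto intro: card_int_half_open_le(1)[OF L])
  have sub: "range x \<subseteq> (\<Union>a\<in>level 1 n. I a)"
  proof safe
    fix k
    have per: "x (j + r * i) = x j" for i j
    proof (induction i)
      case (Suc i)
      have "x (j + r * i + r) = x (j + r * i)" using cyc by (simp add: extreme_cycle_def)
      then show ?case using Suc by (simp add: algebra_simps)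
    qed simp
    \<comment> \<open>To step back \<open>n\<close> times from \<open>x k\<close>, the index is
      first raised by the multiple \<open>r * n\<close> of the period, so that the subtraction on
      naturals is exact.\<close>
    have "n \<le> r * n" using cyc by (simp add: extreme_cycle_def)
    then have "k + (r * n - n) + n = k + r * n" by linarith
    then have eq: "x (k + (r * n - n) + n) = x k" using per[of k n] by (simp only:)
    define k' where "k' = k + (r * n - n)"
    obtain a where a: "a \<in> level 1 n" "4 ^ n * x (k' + n) = x k' + int m * int a"
      using extreme_cycle_iterate[OF cyc] by blast
    have "4 ^ n * x k = x k' + int m * int a" using a(2) eq by (simp add: k'_def)
    then have "of_int (4 ^ n * x k) = (of_int (x k' + int m * int a) :: real)" by (simp only:)
    then have xk: "of_int (x k) = real m * real a / 4 ^ n + of_int (x k') / (4 ^ n :: real)"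
      by (simp add: field_simps)
    have pos: "0 < x k'" and le: "3 * x k' \<le> int m" using extreme_cycle_bounds[OF cyc] by auto
    from le have "of_int (3 * x k') \<le> (of_int (int m) :: real)" by (simp only: of_int_le_iff)
    then have "of_int (x k') / (4 ^ n :: real) \<le> L" by (simp add: L_def field_simps)
    with pos have "x k \<in> I a" by (simp add: I_def xk)
    then show "x k \<in> (\<Union>a\<in>level 1 n. I a)" using a(1) by blast
  qed
  then show "finite (range x)" using fin by (rule finite_subset)
  have "card (range x) \<le> card (\<Union>a\<in>level 1 n. I a)" by (rule card_mono[OF fin sub])
  also have "\<dots> \<le> (\<Sum>a\<in>level 1 n. card (I a))" by (rule card_UN_le) simp
  finally have "int (card (range x)) \<le> (\<Sum>a\<in>level 1 n. int (card (I a)))"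
    by (simp flip: of_nat_sum)
  also have "\<dots> \<le> (\<Sum>a\<in>level 1 n. \<lceil>L\<rceil>)"
    unfolding I_def by (intro sum_mono card_int_half_open_le(2)[OF L])
  also have "\<dots> = int (card (level 1 n)) * \<lceil>L\<rceil>" by simp
  also have "\<dots> \<le> int (2 ^ n) * \<lceil>L\<rceil>"
    using L card_level_le[of 1 n] by (intro mult_right_mono) (auto simp: le_ceiling_iff simp del: of_nat_power)
  finally show "int (card (range x)) \<le> 2 ^ n * \<lceil>real m / (3 * 4 ^ n)\<rceil>" by (simp add: L_def)
qed

lemma extreme_cycle_cong:
  assumes "extreme_cycle m r x"
  shows "[4 ^ k * x k = x 0] (mod int m)"
proof -
  obtain a :: nat where "4 ^ k * x k = x 0 + int m * int a"
    using extreme_cycle_iterate[OF assms, of k 0] by auto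
  then show ?thesis by (simp add: cong_def)
qed

text \<open>All \<open>x i\<close> are coprime to \<open>m\<close>. If \<open>x i = x j\<close>,
  cancelling it from the congruences with \<open>x 0\<close> gives equal powers of 4 modulo
  \<open>m\<close>, so the points with index below the order are distinct.\<close>

lemma ord_le_card_extreme_cycle:
  assumes cyc: "extreme_cycle m r x" and "odd m" and cop: "coprime (x 0) (int m)"
  shows "ord m 4 \<le> card (range x)"
proof -
  have inj: "i = j" if "i \<le> j" "j < ord m 4" "x i = x j" for i j
  proof (rule ccontr)
    assume "i \<noteq> j"
    have c: "[4 ^ i * x i = x 0] (mod int m)" "[4 ^ j * x i = x 0] (mod int m)"
      using extreme_cycle_cong[OF cyc, of i] extreme_cycle_cong[OF cyc, of j] that(3) by auto
    have "coprime (4 ^ i * x i) (int m)"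
      using cong_imp_coprime[OF cong_sym[OF c(1)]] cop by simp
    then have cop_i: "coprime (x i) (int m)" "coprime (4 ^ i) (int m)"
      by (simp_all add: coprime_mult_left_iff)
    have "[4 ^ j * x i = 4 ^ i * x i] (mod int m)"
      using c by (blast intro: cong_trans cong_sym)
    then have "[4 ^ j = (4::int) ^ i] (mod int m)"
      using cong_mult_rcancel[OF cop_i(1)] by blast
    also have "(4::int) ^ j = 4 ^ i * 4 ^ (j - i)"
      using \<open>i \<le> j\<close> by (simp flip: power_add)
    finally have "[4 ^ i * 4 ^ (j - i) = 4 ^ i * (1::int)] (mod int m)" by simp
    then have "[4 ^ (j - i) = (1::int)] (mod int m)"
      using cong_mult_lcancel[OF cop_i(2)] by blast
    then have "[int (4 ^ (j - i)) = int 1] (mod int m)" by simp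
    then have "[4 ^ (j - i) = 1] (mod m)" unfolding cong_int_iff .
    moreover have "0 < j - i" "j - i < ord m 4" using that \<open>i \<noteq> j\<close> by auto
    ultimately show False using ord_minimal by blast
  qed
  have "inj_on x {..<ord m 4}"
  proof (rule inj_onI)
    fix i j assume "i \<in> {..<ord m 4}" "j \<in> {..<ord m 4}" "x i = x j"
    then show "i = j" using inj[of i j] inj[of j i] by (cases "i \<le> j") auto
  qed
  then have "card (x ` {..<ord m 4}) = ord m 4" by (simp add: card_image)
  moreover have "card (x ` {..<ord m 4}) \<le> card (range x)"
    using card_extreme_cycle_le(1)[OF cyc] by (intro card_mono) auto
  ultimately show ?thesis by simp
qed

text \<open>As \<open>4 ^ k * x k\<close> is congruent to \<open>x 0\<close> modulo the odd number
  \<open>d\<close>, every cycle point is divisible by \<open>d\<close>, and so is the digit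
  \<open>m\<close>.\<close>

lemma extreme_cycle_div_gcd:
  assumes cyc: "extreme_cycle m r x" and "odd m"
  defines "d \<equiv> gcd (x 0) (int m)"
  shows "extreme_cycle (m div nat d) r (\<lambda>k. x k div d)"
proof -
  have d: "d dvd x 0" "d dvd int m" by (simp_all add: d_def)
  have "d > 0" using \<open>odd m\<close> by (auto simp: d_def intro!: gcd_pos_int[THEN iffD2] elim: oddE)
  have "odd d" using d(2) \<open>odd m\<close> by (meson dvd_trans even_of_nat)
  then have cop: "coprime d (4 ^ k)" for k
    using coprime_power_right_iff[of d 2 "2 * k"] by (simp add: power_mult)
  have dvd: "d dvd x k" for k
  proof -
    have "d dvd 4 ^ k * x k"
      using cong_dvd_iff[OF cong_dvd_modulus[OF extreme_cycle_cong[OF cyc, of k] d(2)]] d(1) by blast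
    then show ?thesis using cop coprime_dvd_mult_right_iff by blast
  qed
  have md: "int (m div nat d) = int m div d" using \<open>d > 0\<close> by (simp add: zdiv_int)
  have "4 * (x (Suc k) div d) - x k div d \<in> {0, int m div d}" for k
  proof -
    have "4 * (x (Suc k) div d) - x k div d = (4 * x (Suc k) - x k) div d"
      using dvd[of k] dvd[of "Suc k"] \<open>d > 0\<close> by (auto elim!: dvdE simp: algebra_simps simp flip: right_diff_distrib)
    moreover have "4 * x (Suc k) - x k \<in> {0, int m}" using cyc by (simp add: extreme_cycle_def)
    ultimately show ?thesis by auto
  qed
  moreover have "x k div d \<noteq> 0" for k
    using dvd[of k] cyc \<open>d > 0\<close> by (auto simp: extreme_cycle_def dvd_div_eq_0_iff)
  ultimately show ?thesis using cyc unfolding extreme_cycle_def md by simp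
qed

section \<open>Extreme cycles obstruct completeness\<close>

context cantor4
begin

text \<open>At odd integers \<open>phi\<close> vanishes. If the sum is even, it is 4 times a sum of
  the same kind with one digit fewer and the next cycle point, which is why \<open>k\<close> varies
  in the induction.\<close>

lemma phi_add_cycle_eq_0:
  assumes cyc: "extreme_cycle m r x" and "odd m" and "a \<in> level m N"
  shows "phi (of_int (int a + x k)) = 0"
  using assms(3)
proof (induction N arbitrary: a k)
  case 0
  have "phi (of_int (x k)) = 0"
  \<comment> \<open>Descent: an even cycle point is followed by its quarter, which is positive and
    smaller, so an odd point is reached.\<close>
  proof (induction "nat (x k)" arbitrary: k rule: less_induct)
    case less
    show ?case
    proof (cases "even (x k)")
      case True
      have "4 * x (Suc k) - x k \<in> {0, int m}" using cyc by (simp add: extreme_cycle_def)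
      then have eq: "x k = 4 * x (Suc k)"
      proof
        assume "4 * x (Suc k) - x k \<in> {int m}"
        then have "odd (4 * x (Suc k) - x k)" using \<open>odd m\<close> by simp
        with True show ?thesis by simp
      qed simp
      moreover have "nat (x (Suc k)) < nat (x k)"
        using eq extreme_cycle_bounds(1)[OF cyc, of "Suc k"] by simp
      ultimately show ?thesis using less[of "Suc k"] phi_mult_4[of "x (Suc k)"] by simp
    qed (rule phi_odd)
  qed
  with 0 show ?case by simp
next
  case (Suc N)
  obtain b d where b: "b \<in> level m N" "d \<in> {0, m}" "a = d + 4 * b"
    using level_SucD[OF Suc.prems] by blast
  show ?case
  proof (cases "odd (int a + x k)")
    case False
    have "4 * x (Suc k) - x k \<in> {0, int m}" using cyc by (simp add: extreme_cycle_def)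
    then obtain d' where d': "4 * x (Suc k) = x k + int d'" "d' \<in> {0, m}" by force
    have "even (int d + x k)" using False b(3) by simp
    moreover have "even (int d' + x k)" using d'(1) by (metis add.commute dvd_triv_left even_mult_iff even_numeral)
    \<comment> \<open>Since \<open>m\<close> is odd, parity determines a digit. Thus the lowest
      digit of \<open>a\<close> is the digit of the cycle step.\<close>
    ultimately have "even (int d) \<longleftrightarrow> even (int d')" by simp
    with b(2) d'(2) \<open>odd m\<close> have "d = d'" by auto
    then have "int a + x k = 4 * (int b + x (Suc k))" using b(3) d'(1) by simp
    then show ?thesis using Suc.IH[OF b(1), of "Suc k"] phi_mult_4[of "int b + x (Suc k)"] by simp
  qed (rule phi_odd)
qed

lemma not_complete_if_extreme_cycle:
  assumes cyc: "extreme_cycle m r x" and "odd m"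
  shows "\<not> complete_number \<mu> m"
proof
  assume "complete_number \<mu> m"
  define y where "y = real_of_int (x 0)"
  let ?B = "expo ` Gamma_set m"
  have sub: "?B \<subseteq> L2_space \<mu>" by (auto simp: expo_eq_wave wave_L2_space)
  have "wave (- y) \<in> L2_closure \<mu> ?B"
    using \<open>complete_number \<mu> m\<close> complete_number_iff_dense[OF \<open>odd m\<close>] wave_L2_space by blast
  then obtain g where g: "g \<in> cspan ?B" "(\<integral>z. (cmod (wave (- y) z - g z))\<^sup>2 \<partial>\<mu>) < 1"
    unfolding L2_closure_def by (auto dest!: spec[of _ 1])
  \<comment> \<open>This integral is the inner product of \<open>g\<close> with
    \<open>wave (- y)\<close>, which is orthogonal to every generator.\<close>
  have "integrable \<mu> (\<lambda>z. g z * wave y z) \<and> (\<integral>z. g z * wave y z \<partial>\<mu>) = 0"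
    using g(1)
  proof (induction rule: cspan.induct)
    case (step f e c)
    from step.hyps(2) obtain a where a: "a \<in> Gamma_set m" "e = wave (real a)"
      by (auto simp: expo_eq_wave)
    then obtain N where "a \<in> level m N" by (auto simp: Gamma_set_eq_level)
    from phi_add_cycle_eq_0[OF cyc \<open>odd m\<close> this, of 0] have "phi (real a + y) = 0"
      by (simp add: y_def)
    then have "(\<lambda>z. e z * wave y z) = wave (real a + y)" "(\<integral>z. wave (real a + y) z \<partial>\<mu>) = 0"
      by (simp_all add: a wave_mult fun_eq_iff phi_def)
    moreover have "(\<lambda>z. (c * e z + f z) * wave y z) = (\<lambda>z. c * (e z * wave y z) + f z * wave y z)"
      by (simp add: algebra_simps)
    ultimately show ?case using step.IH by (simp add: fun_eq_iff)
  qed simp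
  then have int: "integrable \<mu> (\<lambda>z. g z * wave y z)" and zero: "(\<integral>z. g z * wave y z \<partial>\<mu>) = 0" by auto
  have L2: "(\<lambda>z. wave (- y) z - g z) \<in> L2_space \<mu>"
    by (intro L2_space_diff wave_L2_space cspan_L2_space[OF sub g(1)])
  have eq: "(wave (- y) z - g z) * wave y z = 1 - g z * wave y z" for z
    by (simp add: algebra_simps wave_mult)
  have "1 = cmod (\<integral>z. 1 - g z * wave y z \<partial>\<mu>)"
    using int by (simp add: zero prob_space del: space_eq_univ)
  also have "\<dots> \<le> (\<integral>z. cmod (1 - g z * wave y z) \<partial>\<mu>)"
    by (rule integral_norm_bound)
  \<comment> \<open>The bound \<open>u \<le> 1 / 2 + u\<^sup>2 / 2\<close> takes the place of
    Cauchy-Schwarz and yields a contradiction with squared distance below 1.\<close>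
  also have "\<dots> \<le> (\<integral>z. 1 / 2 + (cmod (wave (- y) z - g z))\<^sup>2 / 2 \<partial>\<mu>)"
  proof (rule integral_mono)
    fix z
    have "cmod (1 - g z * wave y z) = cmod (wave (- y) z - g z)"
      unfolding eq[symmetric] norm_mult by simp
    then show "cmod (1 - g z * wave y z) \<le> 1 / 2 + (cmod (wave (- y) z - g z))\<^sup>2 / 2"
      using sum_squares_bound[of 1 "cmod (wave (- y) z - g z)"] by simp
  qed (use int L2 in \<open>auto simp: L2_space_def\<close>)
  also have "\<dots> < 1"
    using g(2) L2 by (simp add: L2_space_def prob_space del: space_eq_univ)
  finally show False by simp
qed

end

section \<open>Completeness in the absence of extreme cycles\<close>

lemma cos_pi_add_nat: "cos (pi * (t + real n)) = (- 1) ^ n * cos (pi * t)"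
  using cos_npi[of n] sin_npi[of n] by (simp add: distrib_left cos_add mult.commute)

context cantor4
begin

text \<open>For odd \<open>m\<close>, the squared length of the projection of
  \<open>wave (- t)\<close> onto the span of the exponentials of level \<open>N\<close>; see
  \<open>integral_wave_minus_level\<close>.\<close>

definition energy :: "nat \<Rightarrow> nat \<Rightarrow> real \<Rightarrow> real" where
  "energy m N t = (\<Sum>a\<in>level m N. (cmod (phi (t + real a)))\<^sup>2)"

lemma cmod_phi_refine: "(cmod (phi s))\<^sup>2 = (1 + cos (pi * s)) / 2 * (cmod (phi (s / 4)))\<^sup>2"
proof -
  have "(cmod ((1 + cis (pi * s)) / 2))\<^sup>2 = ((1 + cos (pi * s))\<^sup>2 + (sin (pi * s))\<^sup>2) / 4"
    by (simp add: norm_divide power_divide cmod_power2)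
  also have "\<dots> = (1 + cos (pi * s)) / 2"
    using sin_squared_eq[of "pi * s"] by (simp add: power2_sum)
  finally have factor: "(cmod ((1 + cis (pi * s)) / 2))\<^sup>2 = (1 + cos (pi * s)) / 2" .
  have "(cmod (phi s))\<^sup>2 = (cmod (phi (s / 4)))\<^sup>2 * (cmod ((1 + cis (pi * s)) / 2))\<^sup>2"
    by (simp only: phi_refine[of s] norm_mult power_mult_distrib)
  then show ?thesis by (simp only: factor mult.commute)
qed

text \<open>Split by the lowest digit. The shift by \<open>4 * a\<close> keeps the cosine, the shift
  by \<open>m + 4 * a\<close> changes its sign, so the two weights add up to 1.\<close>

lemma energy_refine:
  assumes "odd m"
  shows "energy m (Suc N) t = (1 + cos (pi * t)) / 2 * energy m N (t / 4)
    + (1 - cos (pi * t)) / 2 * energy m N ((t + real m) / 4)"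
proof -
  have 0: "(cmod (phi (t + real (4 * a))))\<^sup>2 = (1 + cos (pi * t)) / 2 * (cmod (phi (t / 4 + real a)))\<^sup>2" for a
    using cmod_phi_refine[of "t + real (4 * a)"] cos_pi_add_nat[of t "4 * a"]
    by (simp add: add_divide_distrib)
  have m: "(cmod (phi (t + real (m + 4 * a))))\<^sup>2 = (1 - cos (pi * t)) / 2 * (cmod (phi ((t + real m) / 4 + real a)))\<^sup>2" for a
  proof -
    have "(t + real (m + 4 * a)) / 4 = (t + real m) / 4 + real a" by (simp add: field_simps)
    moreover have "cos (pi * (t + real (m + 4 * a))) = - cos (pi * t)"
      using assms unfolding cos_pi_add_nat by simp
    ultimately show ?thesis
      using cmod_phi_refine[of "t + real (m + 4 * a)"] by (simp only: diff_conv_add_uminus)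
  qed
  show ?thesis
    unfolding energy_def sum_level_Suc[OF assms] 0 m by (simp only: sum_distrib_left)
qed

lemma energy_nonneg: "0 \<le> energy m N t"
  by (simp add: energy_def sum_nonneg)

lemma energy_mono: "incseq (\<lambda>N. energy m N t)"
  unfolding energy_def by (intro incseq_SucI sum_mono2 level_Suc_mono) auto

lemma energy_0: "energy m 0 t = (cmod (phi t))\<^sup>2"
  by (simp add: energy_def)

lemma continuous_on_energy: "continuous_on A (energy m N)"
proof -
  have "continuous_on A (\<lambda>t. phi (t + real a))" for a
    by (rule continuous_on_compose2[OF continuous_on_phi[of UNIV]]) (auto intro!: continuous_intros)
  then show ?thesis
    unfolding energy_def[abs_def] by (intro continuous_intros)
qed

lemma integral_wave_minus_level:
  assumes "odd m"
  shows "(\<integral>x. (cmod (wave (- t) x - (\<Sum>a\<in>level m N. phi (- t - real a) * wave (real a) x)))\<^sup>2 \<partial>\<mu>) = 1 - energy m N t"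
proof -
  let ?G = "real ` level m N"
  have sum: "(\<Sum>a\<in>?G. f a) = (\<Sum>a\<in>level m N. f (real a))" for f :: "real \<Rightarrow> 'b :: comm_monoid_add"
    by (simp add: sum.reindex)
  have "cmod (phi (- t - a)) = cmod (phi (t + a))" for a
    using phi_minus[of "t + a"] by simp
  then show ?thesis
    using integral_wave_minus_sum[of ?G "- t"] level_orthogonal[OF assms]
    by (auto simp: sum energy_def)
qed

lemma energy_le_1:
  assumes "odd m"
  shows "energy m N t \<le> 1"
proof -
  have "0 \<le> (\<integral>x. (cmod (wave (- t) x - (\<Sum>a\<in>level m N. phi (- t - real a) * wave (real a) x)))\<^sup>2 \<partial>\<mu>)"
    by (rule Bochner_Integration.integral_nonneg) simp
  then show ?thesis unfolding integral_wave_minus_level[OF assms] by simp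
qed

definition total_energy :: "nat \<Rightarrow> real \<Rightarrow> real" where
  "total_energy m t = (SUP N. energy m N t)"

lemma bdd_above_energy: "odd m \<Longrightarrow> bdd_above (range (\<lambda>N. energy m N t))"
  by (rule bdd_aboveI[of _ 1]) (auto intro: energy_le_1)

lemma energy_tendsto: "odd m \<Longrightarrow> (\<lambda>N. energy m N t) \<longlonglongrightarrow> total_energy m t"
  unfolding total_energy_def by (rule LIMSEQ_incseq_SUP[OF bdd_above_energy energy_mono])

lemma energy_le_total: "odd m \<Longrightarrow> energy m N t \<le> total_energy m t"
  unfolding total_energy_def by (rule cSUP_upper[OF _ bdd_above_energy]) auto

lemma total_energy_least: "(\<And>N. energy m N t \<le> c) \<Longrightarrow> total_energy m t \<le> c"
  unfolding total_energy_def by (rule cSUP_least) auto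

lemma total_energy_refine:
  assumes "odd m"
  shows "total_energy m t = (1 + cos (pi * t)) / 2 * total_energy m (t / 4)
    + (1 - cos (pi * t)) / 2 * total_energy m ((t + real m) / 4)"
proof (rule LIMSEQ_unique)
  show "(\<lambda>N. energy m (Suc N) t) \<longlonglongrightarrow> total_energy m t"
    by (rule LIMSEQ_Suc[OF energy_tendsto[OF assms]])
  show "(\<lambda>N. energy m (Suc N) t) \<longlonglongrightarrow> (1 + cos (pi * t)) / 2 * total_energy m (t / 4)
    + (1 - cos (pi * t)) / 2 * total_energy m ((t + real m) / 4)"
    unfolding energy_refine[OF assms] by (intro tendsto_intros energy_tendsto assms)
qed

text \<open>A supremum of continuous functions is lower semicontinuous, hence attains its infimum on
  a compact set. A minimum point is found in the nested compact sublevel sets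
  \<open>S N\<close>.\<close>

lemma total_energy_attains_inf:
  assumes "odd m" "compact K" "K \<noteq> {}"
  obtains t where "t \<in> K" "\<And>u. u \<in> K \<Longrightarrow> total_energy m t \<le> total_energy m u"
proof -
  define c where "c = (INF u\<in>K. total_energy m u)"
  have "0 \<le> total_energy m u" for u
    using energy_le_total[OF \<open>odd m\<close>, of 0 u] energy_nonneg[of m 0 u] by linarith
  then have lower: "c \<le> total_energy m u" if "u \<in> K" for u
    unfolding c_def using that by (intro cINF_lower bdd_belowI[of _ 0]) auto
  define S where "S N = K \<inter> {u. energy m N u \<le> c}" for N
  have "\<Inter>(range S) \<noteq> {}"
  proof (rule compact_nest)
    fix N
    show "compact (S N)"
      unfolding S_def using assms(2)
      by (intro compact_Int_closed closed_Collect_le continuous_on_energy continuous_intros)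
    obtain u where u: "u \<in> K" "\<And>v. v \<in> K \<Longrightarrow> energy m N u \<le> energy m N v"
      using continuous_attains_inf[OF assms(2,3) continuous_on_energy] by blast
    have "energy m N u \<le> c"
      unfolding c_def using u(2) energy_le_total[OF \<open>odd m\<close>, of N] assms(3)
      by (intro cINF_greatest) (auto intro: order_trans)
    then show "S N \<noteq> {}" using u(1) by (auto simp: S_def)
  next
    fix N N' :: nat assume "N \<le> N'"
    then have "energy m N u \<le> energy m N' u" for u by (rule incseqD[OF energy_mono])
    then show "S N' \<subseteq> S N" unfolding S_def by (auto intro: order_trans)
  qed
  then obtain t where t: "\<And>N. t \<in> S N" by blast
  have "total_energy m t \<le> c"
    by (rule total_energy_least) (use t in \<open>auto simp: S_def\<close>)
  with t[of 0] lower show ?thesis by (intro that[of t]) (auto simp: S_def intro: order_trans)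
qed

lemma extreme_cycle_if_small_energy:
  assumes "odd m" and small: "total_energy m t < 1"
  shows "\<exists>r x. extreme_cycle m r x"
proof -
  \<comment> \<open>Large enough that \<open>K\<close> contains \<open>t\<close> and is mapped into
    itself by both steps, since \<open>A + m \<le> 4 * A\<close>.\<close>
  define A where "A = max \<bar>t\<bar> (real m)"
  define K where "K = {- A..A}"
  have A: "0 \<le> A" "real m \<le> A" by (auto simp: A_def)
  have "t \<in> K" by (auto simp: K_def A_def)
  have K_step: "u / 4 \<in> K" "(u + real m) / 4 \<in> K" if "u \<in> K" for u
    using that A by (auto simp: K_def)
  obtain t0 where t0: "t0 \<in> K" "\<And>u. u \<in> K \<Longrightarrow> total_energy m t0 \<le> total_energy m u"
    using total_energy_attains_inf[OF \<open>odd m\<close>, of K] \<open>t \<in> K\<close> by (auto simp: K_def)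
  define c where "c = total_energy m t0"
  have "c < 1" using t0(2)[OF \<open>t \<in> K\<close>] small by (simp add: c_def)
  define M where "M = {u \<in> K. total_energy m u = c}"
  have lower: "0 \<le> total_energy m u - c" if "u \<in> K" for u using t0(2)[OF that] by (simp add: c_def)
  \<comment> \<open>The weights sum to 1, so at a minimum point the weighted excesses over the
    minimum sum to 0. Being nonnegative, each of them vanishes.\<close>
  have convex: "(1 + cos (pi * u)) / 2 * (total_energy m (u / 4) - c)
      + (1 - cos (pi * u)) / 2 * (total_energy m ((u + real m) / 4) - c) = 0" if "u \<in> M" for u
    using total_energy_refine[OF \<open>odd m\<close>, of u] that unfolding M_def by (simp add: field_simps)
  have nonneg: "0 \<le> (1 + cos (pi * u)) / 2 * (total_energy m (u / 4) - c)"
     "0 \<le> (1 - cos (pi * u)) / 2 * (total_energy m ((u + real m) / 4) - c)" if "u \<in> M" for u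
  proof -
    have "0 \<le> 1 + cos (pi * u)" "0 \<le> 1 - cos (pi * u)"
      using cos_ge_minus_one[of "pi * u"] cos_le_one[of "pi * u"] by linarith+
    moreover have "u \<in> K" using that by (simp add: M_def)
    ultimately show "0 \<le> (1 + cos (pi * u)) / 2 * (total_energy m (u / 4) - c)"
      "0 \<le> (1 - cos (pi * u)) / 2 * (total_energy m ((u + real m) / 4) - c)"
      using lower[OF K_step(1)] lower[OF K_step(2)] by (simp_all add: mult_nonneg_nonneg)
  qed
  have step0: "u / 4 \<in> M" if "u \<in> M" "cos (pi * u) \<noteq> - 1" for u
    using convex[OF that(1)] nonneg[OF that(1)] that K_step[of u]
    by (auto simp: M_def add_nonneg_eq_0_iff)
  have stepm: "(u + real m) / 4 \<in> M" if "u \<in> M" "cos (pi * u) \<noteq> 1" for u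
    using convex[OF that(1)] nonneg[OF that(1)] that K_step[of u]
    by (auto simp: M_def add_nonneg_eq_0_iff)
  have phi_le: "(cmod (phi u))\<^sup>2 \<le> c" if "u \<in> M" for u
    using energy_le_total[OF \<open>odd m\<close>, of 0 u] that by (simp add: energy_0 M_def)
  have M_int: "u \<in> \<int>" if "u \<in> M" for u
  proof (rule ccontr)
    assume "u \<notin> \<int>"
    \<comment> \<open>The weight of the step to \<open>u / 4\<close> vanishes only at odd integers,
      so a point that is not an integer can be divided by 4 forever.\<close>
    have "u / 4 ^ n \<in> M \<and> u / 4 ^ n \<notin> \<int>" for n
    proof (induction n)
      case (Suc n)
      let ?v = "u / 4 ^ n"
      have "cos (pi * ?v) \<noteq> - 1"
      proof
        assume "cos (pi * ?v) = - 1"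
        then obtain k :: int where "pi * ?v = (2 * of_int k + 1) * pi"
          unfolding cos_eq_minus1 by blast
        then have "pi * ?v = pi * of_int (2 * k + 1)" by (simp only: of_int_add of_int_mult mult.commute) simp
        then have "?v = of_int (2 * k + 1)" using mult_left_cancel[OF pi_neq_zero] by blast
        with Suc show False by (metis Ints_of_int)
      qed
      with Suc step0 have "?v / 4 \<in> M" by blast
      moreover have "?v / 4 \<notin> \<int>"
      proof
        assume "?v / 4 \<in> \<int>"
        then have "4 * (?v / 4) \<in> \<int>" by (intro Ints_mult) auto
        with Suc show False by simp
      qed
      ultimately show ?case by (simp add: field_simps)
    qed (use that \<open>u \<notin> \<int>\<close> in auto)
    then have le: "(cmod (phi (u / 4 ^ n)))\<^sup>2 \<le> c" for n using phi_le by blast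
    have "(\<lambda>n. u / 4 ^ n) \<longlonglongrightarrow> 0"
      using LIMSEQ_divide_realpow_zero[of 4 u] by simp
    then have "(\<lambda>n. (cmod (phi (u / 4 ^ n)))\<^sup>2) \<longlonglongrightarrow> (cmod (phi 0))\<^sup>2"
      by (intro tendsto_intros isCont_tendsto_compose[OF isCont_phi])
    then have "(cmod (phi 0))\<^sup>2 \<le> c"
      by (rule LIMSEQ_le_const2) (use le in auto)
    with \<open>c < 1\<close> show False by simp
  qed
  define Z where "Z = {z::int. of_int z \<in> M}"
  \<comment> \<open>At an integer one weight is 1 and the other 0; \<open>s\<close> takes the step
    of weight 1. The division by 4 is exact because the new minimum point is again an
    integer.\<close>
  define s where "s z = (if even z then z div 4 else (z + int m) div 4)" for z
  have s: "s z \<in> Z" "4 * s z - z \<in> {0, int m}" if "z \<in> Z" for z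
  proof -
    define w where "w = (if even z then z else z + int m)"
    have "cos (pi * of_int z) = (if even z then 1 else - 1)"
      using arg_cong[OF cis_pi_int[of z], of Re] by (auto split: if_splits)
    then have wM: "of_int w / 4 \<in> M"
      using step0[of "of_int z"] stepm[of "of_int z"] that by (auto simp: Z_def w_def)
    then obtain v where v: "of_int w / 4 = (of_int v :: real)" using M_int Ints_cases by metis
    then have "of_int w = (of_int (4 * v) :: real)" by simp
    then have w: "w = 4 * v" unfolding of_int_eq_iff .
    have sw: "s z = w div 4" by (simp add: s_def w_def)
    show "s z \<in> Z" using wM v w by (simp add: sw Z_def)
    show "4 * s z - z \<in> {0, int m}" using w by (auto simp: sw w_def split: if_splits)
  qed
  have "finite Z"
  proof (rule finite_subset)
    show "Z \<subseteq> {- \<lceil>A\<rceil>..\<lceil>A\<rceil>}"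
    proof
      fix z assume "z \<in> Z"
      then have "- A \<le> of_int z" "of_int z \<le> A" by (auto simp: Z_def M_def K_def)
      then have "- \<lceil>A\<rceil> \<le> z" "z \<le> \<lceil>A\<rceil>" by linarith+
      then show "z \<in> {- \<lceil>A\<rceil>..\<lceil>A\<rceil>}" by simp
    qed
  qed simp
  \<comment> \<open>The value \<open>phi 0 = 1\<close> exceeds \<open>c\<close>, so 0 is not a
    minimum point.\<close>
  have nz: "z \<noteq> 0" if "z \<in> Z" for z
    using phi_le[of "of_int z"] that \<open>c < 1\<close> by (auto simp: Z_def)
  have "t0 \<in> M" using t0 by (simp add: M_def c_def)
  then obtain z0 where "z0 \<in> Z" using M_int[of t0] by (auto simp: Z_def elim!: Ints_cases)
  define y where "y k = (s ^^ k) z0" for k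
  have y: "y k \<in> Z" for k by (induction k) (auto simp: y_def \<open>z0 \<in> Z\<close> s)
  then have "finite (range y)" using \<open>finite Z\<close> by (auto intro: finite_subset)
  then have "\<not> inj y" using finite_imageD by blast
  then obtain i j where ij: "i < j" "y i = y j"
    by (metis injI linorder_neqE_nat)
  \<comment> \<open>The orbit in a finite set repeats; dropping the part before index
    \<open>i\<close> leaves a periodic sequence of period \<open>j - i\<close>.\<close>
  define x where "x k = y (i + k)" for k
  have "x (k + (j - i)) = x k" for k
  proof -
    have add: "y (n + k) = (s ^^ k) (y n)" for n
      unfolding y_def by (simp add: add.commute[of n] funpow_add)
    have "x (k + (j - i)) = y (j + k)" using ij(1) by (simp add: x_def add.commute)
    then show ?thesis using ij(2) by (simp add: add x_def)
  qed
  moreover have "4 * x (Suc k) - x k \<in> {0, int m}" for k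
    using s(2)[OF y[of "i + k"]] by (simp add: x_def y_def)
  moreover have "x k \<noteq> 0" for k using nz y by (simp add: x_def)
  ultimately have "extreme_cycle m (j - i) x" using ij(1) by (simp add: extreme_cycle_def)
  then show ?thesis by blast
qed

text \<open>Total energy 1 means that the projections onto the levels converge to
  \<open>wave (- t)\<close>. All real frequencies then lie in the closure, and these are
  total.\<close>

lemma complete_if_no_extreme_cycle:
  assumes "odd m" and no_cycle: "\<And>r x. \<not> extreme_cycle m r x"
  shows "complete_number \<mu> m"
proof -
  let ?B = "expo ` Gamma_set m"
  have sub: "?B \<subseteq> L2_space \<mu>" by (auto simp: expo_eq_wave wave_L2_space)
  have "wave (- t) \<in> L2_closure \<mu> ?B" for t
    unfolding L2_closure_def
  proof (intro CollectI conjI wave_L2_space allI impI)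
    fix \<epsilon> :: real assume "\<epsilon> > 0"
    have "1 \<le> total_energy m t"
      using extreme_cycle_if_small_energy[OF \<open>odd m\<close>, of t] no_cycle by force
    then obtain N where N: "1 - \<epsilon> < energy m N t"
      using order_tendstoD(1)[OF energy_tendsto[OF \<open>odd m\<close>], of "1 - \<epsilon>" t] \<open>\<epsilon> > 0\<close>
      by (auto simp: eventually_sequentially)
    define g where "g x = (\<Sum>a\<in>level m N. phi (- t - real a) * wave (real a) x)" for x
    have "wave (real a) \<in> ?B" if "a \<in> level m N" for a
      using that by (auto simp: Gamma_set_eq_level expo_eq_wave)
    then have "g \<in> cspan ?B"
      unfolding g_def[abs_def] by (intro cspan_sum cspan_scale cspan_superset) auto
    moreover have "(\<integral>x. (cmod (wave (- t) x - g x))\<^sup>2 \<partial>\<mu>) < \<epsilon>"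
      unfolding g_def integral_wave_minus_level[OF \<open>odd m\<close>] using N by simp
    ultimately show "\<exists>g\<in>cspan ?B. (\<integral>x. (cmod (wave (- t) x - g x))\<^sup>2 \<partial>\<mu>) < \<epsilon>" by blast
  qed
  then have "range wave \<subseteq> L2_closure \<mu> ?B"
    by (metis image_subsetI minus_minus)
  then show ?thesis
    unfolding complete_number_iff_dense[OF \<open>odd m\<close>]
    using L2_closure_trans[OF sub] waves_total[OF support] by blast
qed

end

section \<open>The order of 4 against the number of cycle points\<close>

theorem theorem3p11:
  fixes \<mu> :: "real measure" and m :: nat
  assumes "cantor4_measure \<mu>"
    and "odd m"
    and "\<exists>n::nat. int (ord m 4) > 2 ^ n * \<lceil>real m / (3 * 4 ^ n)\<rceil>"
  shows "((\<forall>d. d dvd m \<and> d < m \<longrightarrow> complete_number \<mu> d) \<longrightarrow> complete_number \<mu> m)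
    \<and> \<not> primitive_number \<mu> m"
proof -
  interpret cantor4 \<mu> using assms(1) by (rule cantor4_measure_locale)
  have "complete_number \<mu> m" if divisors: "\<And>d. d dvd m \<Longrightarrow> d < m \<Longrightarrow> complete_number \<mu> d"
  proof (rule complete_if_no_extreme_cycle[OF \<open>odd m\<close>], rule notI)
    fix r x assume cyc: "extreme_cycle m r x"
    define d where "d = nat (gcd (x 0) (int m))"
    have m: "m > 0" using \<open>odd m\<close> by (rule odd_pos)
    then have d: "d > 0" "d dvd m" by (auto simp: d_def nat_dvd_iff)
    show False
    proof (cases "d = 1")
      case True
      then have "coprime (x 0) (int m)" by (simp add: d_def coprime_iff_gcd_eq_1 nat_eq_iff)
      then have "ord m 4 \<le> card (range x)" by (rule ord_le_card_extreme_cycle[OF cyc \<open>odd m\<close>])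
      moreover obtain n :: nat where "int (ord m 4) > 2 ^ n * \<lceil>real m / (3 * 4 ^ n)\<rceil>"
        using assms(3) by blast
      ultimately show False using card_extreme_cycle_le(2)[OF cyc, of n] by linarith
    next
      \<comment> \<open>Dividing by the gcd moves the cycle to the smaller divisor
        \<open>m div d\<close>, which is complete by assumption but cannot be so with a
        cycle.\<close>
      case False
      have dvd: "m div d dvd m" using d by (simp add: div_dvd_iff_mult)
      then have "odd (m div d)" using \<open>odd m\<close> dvd_trans by blast
      then have "\<not> complete_number \<mu> (m div d)"
        using not_complete_if_extreme_cycle extreme_cycle_div_gcd[OF cyc \<open>odd m\<close>] by (simp add: d_def)
      moreover have "m div d < m" using d False m by (intro div_less_dividend) auto
      ultimately show False using divisors dvd by blast
    qed
  qed
  \<comment> \<open>A primitive \<open>m\<close> would have only complete proper divisors and thus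
    be complete itself.\<close>
  then show ?thesis unfolding primitive_number_def by blast
qed

end
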